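(* Let $n$, $m$, $\mu$, $\lambda$ and $k$ be positive integers such that (i) $\mu>\lambda$ and $m\ge n-1$; or (ii) $\lambda=1$, $\mu=2$ and $m=n-2$; or (iii) $\mu>\lambda$, $n=3$ and $m=1$. Then a strong path decomposition $\mathcal{A}$ of $\lambda K_n$ of size $k$ can be enclosed in a Hamiltonian decomposition of $\mu K_{n+m}$ if and only if all of the following hold: (M1) $k=\frac{\mu(m+n-1)}{2}$; (M2) $\sum_{i=0}^{n-m}(n-m-i)\,|\mathcal{S}_i(\mathcal{A})|\le(\mu-\lambda)\frac{n(n-1)}{2}$ (an empty sum is $0$); (M3) if (ii) or (iii) holds, then for every pair of distinct vertices $u,v$ of $K_n$, $|\mathcal{S}_1(u,v,\mathcal{A})|\le(\mu-\lambda)\left(\frac{n(n-1)}{2}-1\right)-|\mathcal{S}_0(\mathcal{A})|$.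
   Context: Graphs may have multiple edges. For a positive integer $\lambda$, $\lambda K_n$ is the loopless multigraph on $n$ vertices in which every pair of distinct vertices is joined by exactly $\lambda$ edges. A decomposition of size $k$ of a graph $G$ is an ordered $k$-tuple $(G(1),\dots,G(k))$ of spanning subgraphs of $G$ (called colour classes; a colour class may have no edges) whose edge sets are pairwise disjoint with union $E(G)$. A path decomposition is a decomposition in which every colour class is a vertex-disjoint union of paths and cycles (isolated vertices count as trivial paths; two parallel edges form a cycle of length 2); it is strong if no colour class contains a cycle (including cycles of length 2). A Hamiltonian decomposition is a decomposition in which every colour class is a Hamiltonian cycle. For $\mu>\lambda$, a decomposition $(G(1),\dots,G(k))$ of $\lambda K_n$ is enclosed in a decomposition $(H(1),\dots,H(k))$ of $\mu K_{n+m}$ (where $\lambda K_n$ is regarded as a subgraph of $\mu K_{n+m}$ on $n$ of its vertices) if $G(i)\subseteq H(i)$ for every $i$. For a decomposition $\mathcal{A}$, $\mathcal{S}_i(\mathcal{A})$ is the set of colour classes of $\mathcal{A}$ with exactly $i$ edges, and for distinct vertices $u,v$, $\mathcal{S}_1(u,v,\mathcal{A})$ is the set of colour classes in $\mathcal{S}_1(\mathcal{A})$ whose single edge joins $u$ and $v$. *)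

theory Defs
  imports Complex_Main "HOL-Library.Multiset"
begin

text \<open>Multigraphs on vertex set nat: a (spanning sub)graph is a multiset of edges,
each edge being a 2-element vertex set; parallel edges are repeated elements.
lambda K_n lives on the vertex set {0..<n}; it is regarded as the subgraph of
mu K_(n+m) on the vertices {0..<n} of {0..<n+m}.\<close>

definition is_edge :: "nat set \<Rightarrow> nat set \<Rightarrow> bool" where
  "is_edge V e \<longleftrightarrow> e \<subseteq> V \<and> card e = 2"

definition path_edges :: "nat list \<Rightarrow> nat set multiset" where
  "path_edges vs = mset (map (\<lambda>i. {vs ! i, vs ! Suc i}) [0..<length vs - 1])"

text \<open>Edges of the cycle v0 v1 ... v(l-1) v0 (for l = 2 this is two parallel edges).\<close>
definition cycle_edges :: "nat list \<Rightarrow> nat set multiset" where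
  "cycle_edges vs = mset (map (\<lambda>i. {vs ! i, vs ! ((Suc i) mod length vs)}) [0..<length vs])"

definition is_path :: "nat list \<Rightarrow> bool" where
  "is_path vs \<longleftrightarrow> distinct vs \<and> vs \<noteq> []"

definition is_cycle :: "nat list \<Rightarrow> bool" where
  "is_cycle vs \<longleftrightarrow> distinct vs \<and> length vs \<ge> 2"

definition comp_edges :: "bool \<times> nat list \<Rightarrow> nat set multiset" where
  "comp_edges c = (if fst c then cycle_edges (snd c) else path_edges (snd c))"

definition comp_ok :: "bool \<times> nat list \<Rightarrow> bool" where
  "comp_ok c \<longleftrightarrow> (if fst c then is_cycle (snd c) else is_path (snd c))"

text \<open>G is a vertex-disjoint union of paths and cycles (isolated vertices being trivial paths).\<close>
definition paths_and_cycles :: "nat set multiset \<Rightarrow> bool" where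
  "paths_and_cycles G \<longleftrightarrow>
     (\<exists>cs :: (bool \<times> nat list) list.
        (\<forall>c\<in>set cs. comp_ok c) \<and>
        (\<forall>i j. i < j \<and> j < length cs \<longrightarrow> set (snd (cs ! i)) \<inter> set (snd (cs ! j)) = {}) \<and>
        G = sum_list (map comp_edges cs))"

definition contains_cycle :: "nat set multiset \<Rightarrow> bool" where
  "contains_cycle G \<longleftrightarrow> (\<exists>vs. is_cycle vs \<and> cycle_edges vs \<subseteq># G)"

definition decomposition :: "nat \<Rightarrow> nat set \<Rightarrow> nat \<Rightarrow> (nat \<Rightarrow> nat set multiset) \<Rightarrow> bool" where
  "decomposition lam V k G \<longleftrightarrow>
     (\<forall>i<k. \<forall>e\<in>#G i. is_edge V e) \<and>
     (\<forall>e. is_edge V e \<longrightarrow> (\<Sum>i<k. count (G i) e) = lam)"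

definition path_decomposition :: "nat \<Rightarrow> nat set \<Rightarrow> nat \<Rightarrow> (nat \<Rightarrow> nat set multiset) \<Rightarrow> bool" where
  "path_decomposition lam V k G \<longleftrightarrow>
     decomposition lam V k G \<and> (\<forall>i<k. paths_and_cycles (G i))"

definition strong_path_decomposition :: "nat \<Rightarrow> nat set \<Rightarrow> nat \<Rightarrow> (nat \<Rightarrow> nat set multiset) \<Rightarrow> bool" where
  "strong_path_decomposition lam V k G \<longleftrightarrow>
     path_decomposition lam V k G \<and> (\<forall>i<k. \<not> contains_cycle (G i))"

definition hamiltonian_cycle :: "nat set \<Rightarrow> nat set multiset \<Rightarrow> bool" where
  "hamiltonian_cycle V H \<longleftrightarrow> (\<exists>vs. is_cycle vs \<and> set vs = V \<and> H = cycle_edges vs)"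

definition hamiltonian_decomposition :: "nat \<Rightarrow> nat set \<Rightarrow> nat \<Rightarrow> (nat \<Rightarrow> nat set multiset) \<Rightarrow> bool" where
  "hamiltonian_decomposition mu V k H \<longleftrightarrow>
     decomposition mu V k H \<and> (\<forall>i<k. hamiltonian_cycle V (H i))"

definition enclosed_in_hamiltonian ::
  "nat \<Rightarrow> nat \<Rightarrow> nat \<Rightarrow> nat \<Rightarrow> (nat \<Rightarrow> nat set multiset) \<Rightarrow> bool" where
  "enclosed_in_hamiltonian mu n m k G \<longleftrightarrow>
     (\<exists>H. hamiltonian_decomposition mu {0..<n+m} k H \<and> (\<forall>i<k. G i \<subseteq># H i))"

definition S_card :: "nat \<Rightarrow> (nat \<Rightarrow> nat set multiset) \<Rightarrow> nat \<Rightarrow> nat" where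
  "S_card k G i = card {j. j < k \<and> size (G j) = i}"

definition S1_card :: "nat \<Rightarrow> (nat \<Rightarrow> nat set multiset) \<Rightarrow> nat \<Rightarrow> nat \<Rightarrow> nat" where
  "S1_card k G u v = card {j. j < k \<and> G j = {#{u, v}#}}"

end

theory Submission
  imports Defs
begin

text \<open>Necessity is a count of the edges of the Hamiltonian cycles inside \<open>K\<^sub>n\<close>.
  For sufficiency, \<open>\<A>\<close> is first enclosed in a decomposition of \<open>\<mu>K\<^sub>n\<close> into \<open>k\<close> linear forests with
  at least \<open>n - m\<close> edges each. That decomposition is then extended by one vertex at a time:
  when \<open>m\<close> vertices are missing, every vertex is \<open>\<mu>m\<close> times a path end (an isolated vertex counting as two
  ends), and joining a suitable \<open>m\<close>-th part of all path ends to the new vertex preserves the invariants.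
  It is found by rounding the fractional choice of weight \<open>1/m\<close> for every path end, which is
  possible by the integrality of circulations. Once only one vertex is missing, all classes are Hamiltonian
  paths, which it closes to cycles.\<close>

section \<open>Integral rounding of circulations\<close>

text \<open>The number \<open>n - m\<close> appears because deleting \<open>m\<close> vertices from
  a Hamiltonian cycle leaves at most \<open>m\<close> paths, so every class needs that many edges on
  the old vertices; (M2) asks that the spare copies can make up for what the classes lack. In case
  (i) a class lacks at most one edge and any spare edge serves. If \<open>n = m + 2\<close>, an
  empty class needs two different edges and a class \<open>{#{u, v}#}\<close> needs an edge other
  than \<open>{u, v}\<close>, which is where (M3) comes from. The remaining copies in
  \<open>\<mu>K\<^sub>n\<close> must then be placed without closing cycles. An edge fits into any
  class in which its two vertices have total degree at most 1. If an edge is left over, its vertices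
  have total degree at least 2 in all \<open>k\<close> classes, which is impossible for
  \<open>k \<ge> mu * (n - 1)\<close>. Case (i) satisfies this bound, case (ii) misses it by exactly
  one, and that single unit is what the exchange argument has to recover. Case (iii) may miss it by
  much more, but there two edges per class already are all the edges available.\<close>

lemma homogeneous_system:
  fixes c :: "'i \<Rightarrow> 'a \<Rightarrow> real"
  assumes "finite I" "finite F" "card I < card F"
  shows "\<exists>d. (\<exists>a\<in>F. d a \<noteq> 0) \<and> (\<forall>i\<in>I. (\<Sum>a\<in>F. c i a * d a) = 0)"
  using assms
proof (induction I arbitrary: F c rule: finite_induct)
  case empty
  then have "F \<noteq> {}" by auto
  then show ?case by (intro exI[of _ "\<lambda>_. 1"]) auto
next
  case (insert i I)
  show ?case
  proof (cases "\<forall>a\<in>F. c i a = 0")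
    case True
    have "card I < card F" using insert by simp
    then obtain d where "\<exists>a\<in>F. d a \<noteq> 0" "\<forall>i\<in>I. (\<Sum>a\<in>F. c i a * d a) = 0"
      using insert.IH[OF insert.prems(1)] by blast
    then show ?thesis using True by (intro exI[of _ d]) auto
  next
    case False
    then obtain b where b: "b \<in> F" "c i b \<noteq> 0" by auto
    define F' where "F' = F - {b}"
    have fin: "finite F'" and card: "card I < card F'"
      using insert b unfolding F'_def by auto
    have F: "F = insert b F'" "b \<notin> F'" using b by (auto simp: F'_def)
    \<comment> \<open>Gaussian elimination: these are the coefficients of equation \<open>j\<close>
      after equation \<open>i\<close> has been solved for the unknown \<open>b\<close>.\<close>
    obtain d where d: "\<exists>a\<in>F'. d a \<noteq> 0"
        "\<forall>j\<in>I. (\<Sum>a\<in>F'. (c j a - c j b * c i a / c i b) * d a) = 0"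
      using insert.IH[OF fin card, of "\<lambda>j a. c j a - c j b * c i a / c i b"] by blast
    define d' where "d' = d(b := - (\<Sum>a\<in>F'. c i a * d a) / c i b)"
    have eq: "(\<Sum>a\<in>F. c j a * d' a) = (\<Sum>a\<in>F'. (c j a - c j b * c i a / c i b) * d a)" for j
    proof -
      have "(\<Sum>a\<in>F. c j a * d' a) = c j b * d' b + (\<Sum>a\<in>F'. c j a * d' a)"
        using fin F by simp
      also have "(\<Sum>a\<in>F'. c j a * d' a) = (\<Sum>a\<in>F'. c j a * d a)"
        using F by (intro sum.cong) (auto simp: d'_def)
      also have "c j b * d' b = - (\<Sum>a\<in>F'. c j b * c i a / c i b * d a)"
        by (simp add: d'_def sum_distrib_left sum_divide_distrib mult_ac)
      finally show ?thesis by (simp add: sum_subtractf left_diff_distrib)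
    qed
    have "(\<Sum>a\<in>F. c i a * d' a) = 0" unfolding eq using b by simp
    moreover have "\<exists>a\<in>F. d' a \<noteq> 0" using d(1) F by (auto simp: d'_def)
    ultimately show ?thesis using d(2) eq by (intro exI[of _ d']) auto
  qed
qed

lemma sum_card_fibres:
  assumes "finite S" "finite T" "g ` S \<subseteq> T"
  shows "(\<Sum>y\<in>T. card {x\<in>S. g x = y}) = card S"
  using sum.group[OF assms, of "\<lambda>_. 1::nat"] by simp

text \<open>On the arcs with non-integral value there is a nonzero circulation, because every vertex
  touched by such arcs meets at least two of them. Moving \<open>f\<close> along it until some arc
  becomes integral respects floors and ceilings and leaves fewer non-integral arcs.\<close>

theorem circulation_rounding:
  fixes f :: "'a \<Rightarrow> real" and s t :: "'a \<Rightarrow> 'v"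
  assumes "finite A"
    and "\<And>v. sum f {a\<in>A. s a = v} = sum f {a\<in>A. t a = v}"
  shows "\<exists>g :: 'a \<Rightarrow> int. (\<forall>v. sum g {a\<in>A. s a = v} = sum g {a\<in>A. t a = v}) \<and>
           (\<forall>a\<in>A. \<lfloor>f a\<rfloor> \<le> g a \<and> g a \<le> \<lceil>f a\<rceil>)"
  using assms(2)
proof (induction "card {a\<in>A. f a \<notin> \<int>}" arbitrary: f rule: less_induct)
  case less
  note cons = less.prems
  define F where "F = {a\<in>A. f a \<notin> \<int>}"
  have finF: "finite F" using assms(1) by (simp add: F_def)
  show ?case
  proof (cases "F = {}")
    case True
    have "real_of_int \<lfloor>f a\<rfloor> = f a" if "a \<in> A" for a
      using True that by (simp add: F_def)
    then have eq: "real_of_int (\<Sum>a\<in>{a\<in>A. r a = v}. \<lfloor>f a\<rfloor>) = sum f {a\<in>A. r a = v}" for r :: "'a \<Rightarrow> 'v" and v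
      unfolding of_int_sum by (intro sum.cong) auto
    have "real_of_int (\<Sum>a\<in>{a\<in>A. s a = v}. \<lfloor>f a\<rfloor>) = real_of_int (\<Sum>a\<in>{a\<in>A. t a = v}. \<lfloor>f a\<rfloor>)" for v
      unfolding eq by (rule cons)
    then have "(\<Sum>a\<in>{a\<in>A. s a = v}. \<lfloor>f a\<rfloor>) = (\<Sum>a\<in>{a\<in>A. t a = v}. \<lfloor>f a\<rfloor>)" for v
      by (simp only: of_int_eq_iff)
    then show ?thesis by (intro exI[of _ "\<lambda>a. \<lfloor>f a\<rfloor>"]) auto
  next
    case False
    define W where "W = s ` F \<union> t ` F"
    have finW: "finite W" using finF by (simp add: W_def)
    have split: "sum f {a\<in>A. r a = v} - sum f {a\<in>F. r a = v} \<in> \<int>" for r :: "'a \<Rightarrow> 'v" and v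
    proof -
      have "sum f {a\<in>A. r a = v} - sum f {a\<in>F. r a = v} = sum f ({a\<in>A. r a = v} - {a\<in>F. r a = v})"
        by (rule sum_diff[symmetric]) (use assms(1) in \<open>auto simp: F_def\<close>)
      also have "\<dots> \<in> \<int>" by (rule Ints_sum) (auto simp: F_def)
      finally show ?thesis .
    qed
    \<comment> \<open>By conservation the non-integral arcs at \<open>v\<close> have an integral
      balance, so a single one of them cannot occur alone; a loop is counted at both of its
      ends.\<close>
    have inc: "2 \<le> card {a\<in>F. s a = v} + card {a\<in>F. t a = v}" if "v \<in> W" for v
    proof (rule ccontr)
      assume "\<not> ?thesis"
      moreover have "card {a\<in>F. s a = v} + card {a\<in>F. t a = v} \<noteq> 0"
        using that finF by (auto simp: W_def)
      ultimately consider "card {a\<in>F. s a = v} = 1" "card {a\<in>F. t a = v} = 0"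
        | "card {a\<in>F. s a = v} = 0" "card {a\<in>F. t a = v} = 1" by linarith
      then obtain a where a: "a \<in> F"
        "sum f {a\<in>F. s a = v} - sum f {a\<in>F. t a = v} \<in> {f a, - f a}"
      proof cases
        case 1
        then obtain a where a: "{a\<in>F. s a = v} = {a}" by (auto simp: card_1_singleton_iff)
        have empty: "{a\<in>F. t a = v} = {}" using 1 finF by simp
        have "a \<in> F" using a by blast
        then show ?thesis using that[of a] unfolding a empty by simp
      next
        case 2
        then obtain a where a: "{a\<in>F. t a = v} = {a}" by (auto simp: card_1_singleton_iff)
        have empty: "{a\<in>F. s a = v} = {}" using 2 finF by simp
        have "a \<in> F" using a by blast
        then show ?thesis using that[of a] unfolding a empty by simp
      qed
      have "sum f {a\<in>F. s a = v} - sum f {a\<in>F. t a = v} \<in> \<int>"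
        using Ints_diff[OF split[of t v] split[of s v]] cons[of v] by simp
      then have "f a \<in> \<int>" using a(2) by (auto simp: minus_in_Ints_iff)
      then show False using a(1) by (simp add: F_def)
    qed
    have "2 * card W = (\<Sum>v\<in>W. 2)" by simp
    also have "\<dots> \<le> (\<Sum>v\<in>W. card {a\<in>F. s a = v} + card {a\<in>F. t a = v})"
      by (rule sum_mono) (rule inc)
    also have "\<dots> = 2 * card F"
      using sum_card_fibres[OF finF finW, of s] sum_card_fibres[OF finF finW, of t]
      by (simp add: sum.distrib W_def)
    finally have cardW: "card W \<le> card F" by simp
    obtain v0 where v0: "v0 \<in> W" using False by (auto simp: W_def)
    \<comment> \<open>The balances of all vertices add up to 0, so the equation at \<open>v0\<close>
      follows from the others. Dropping it leaves fewer equations than unknowns.\<close>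
    have "card (W - {v0}) < card F" using v0 cardW finW by (metis card_Diff1_less order_less_le_trans)
    then obtain d where d: "\<exists>a\<in>F. d a \<noteq> 0"
      "\<forall>v\<in>W - {v0}. (\<Sum>a\<in>F. (of_bool (s a = v) - of_bool (t a = v)) * d a) = (0::real)"
      using homogeneous_system[OF _ finF, of "W - {v0}" "\<lambda>v a. of_bool (s a = v) - of_bool (t a = v)"]
        finW by blast
    have "(\<Sum>v\<in>W. \<Sum>a\<in>F. (of_bool (s a = v) - of_bool (t a = v)) * d a) =
          (\<Sum>a\<in>F. \<Sum>v\<in>W. (of_bool (s a = v) - of_bool (t a = v)) * d a)" by (rule sum.swap)
    also have "\<dots> = (\<Sum>a\<in>F. (\<Sum>v\<in>W. of_bool (s a = v) - of_bool (t a = v)) * d a)"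
      by (simp add: sum_distrib_right)
    also have "\<dots> = 0"
      using finW by (intro sum.neutral) (auto simp: sum_subtractf W_def of_bool_def)
    finally have total: "(\<Sum>v\<in>W. \<Sum>a\<in>F. (of_bool (s a = v) - of_bool (t a = v)) * d a) = 0" .
    have dW: "(\<Sum>a\<in>F. (of_bool (s a = v) - of_bool (t a = v)) * d a) = 0" for v
    proof (cases "v \<in> W")
      case True
      have "(\<Sum>a\<in>F. (of_bool (s a = v0) - of_bool (t a = v0)) * d a) = 0"
        using total d(2) v0 finW by (simp add: sum.remove)
      then show ?thesis using d(2) True by (cases "v = v0") auto
    next
      case False
      then show ?thesis by (intro sum.neutral) (auto simp: W_def)
    qed
    define d' where "d' a = (if a \<in> F then d a else 0)" for a
    have sumd: "sum d' {a\<in>A. r a = v} = (\<Sum>a\<in>F. of_bool (r a = v) * d a)" for r :: "'a \<Rightarrow> 'v" and v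
    proof -
      have "sum d' {a\<in>A. r a = v} = sum d {a\<in>F. r a = v}"
        using assms(1) by (intro sum.mono_neutral_cong_right) (auto simp: F_def d'_def)
      also have "\<dots> = (\<Sum>a\<in>F. of_bool (r a = v) * d a)"
        using finF by (intro sum.mono_neutral_cong_left) auto
      finally show ?thesis .
    qed
    have dcons: "sum d' {a\<in>A. s a = v} = sum d' {a\<in>A. t a = v}" for v
      using dW[of v] by (simp add: sumd left_diff_distrib sum_subtractf)
    \<comment> \<open>The step length at which arc \<open>a\<close> reaches the next integer in the
      direction of \<open>d\<close>. The minimum over \<open>D\<close> stops at the first arc to do
      so.\<close>
    define \<tau> where "\<tau> a = (if d a > 0 then (\<lceil>f a\<rceil> - f a) / d a else (\<lfloor>f a\<rfloor> - f a) / d a)" for a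
    define D where "D = {a\<in>F. d a \<noteq> 0}"
    have D: "finite D" "D \<noteq> {}" using finF d(1) by (auto simp: D_def)
    have "Min (\<tau> ` D) \<in> \<tau> ` D" using D by (intro Min_in) auto
    then obtain b where b: "b \<in> D" "\<tau> b = Min (\<tau> ` D)" by force
    have \<tau>: "0 \<le> \<tau> b" "\<And>a. a \<in> D \<Longrightarrow> \<tau> b \<le> \<tau> a"
    proof -
      have "\<lfloor>f b\<rfloor> - f b \<le> 0" "0 \<le> \<lceil>f b\<rceil> - f b" by linarith+
      then show "0 \<le> \<tau> b" by (simp add: \<tau>_def divide_nonpos_nonpos zero_le_divide_iff)
      show "\<tau> b \<le> \<tau> a" if "a \<in> D" for a using D that b(2) by simp
    qed
    define f' where "f' a = f a + \<tau> b * d' a" for a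
    have bounds: "\<lfloor>f a\<rfloor> \<le> f' a" "f' a \<le> \<lceil>f a\<rceil>" for a
    proof -
      have "\<lfloor>f a\<rfloor> \<le> f' a \<and> f' a \<le> \<lceil>f a\<rceil>"
      proof (cases "a \<in> D")
        case True
        then have d'a: "d' a = d a" "d a \<noteq> 0" by (auto simp: D_def d'_def)
        have le: "\<tau> b \<le> \<tau> a" using \<tau> True by auto
        show ?thesis
        proof (cases "d a > 0")
          case True
          then have "\<tau> b * d a \<le> \<lceil>f a\<rceil> - f a" using le by (simp add: \<tau>_def field_simps)
          moreover have "0 \<le> \<tau> b * d a" using \<tau> True by simp
          ultimately show ?thesis unfolding f'_def d'a(1) by linarith
        next
          case False
          then have "d a < 0" using d'a by auto
          then have "\<tau> b * d a \<ge> \<lfloor>f a\<rfloor> - f a" using le by (simp add: \<tau>_def field_simps)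
          moreover have "0 \<ge> \<tau> b * d a" using \<tau> \<open>d a < 0\<close> by (simp add: mult_nonneg_nonpos)
          ultimately show ?thesis unfolding f'_def d'a(1) by linarith
        qed
      next
        case False
        then have "d' a = 0" by (auto simp: D_def d'_def)
        then show ?thesis by (simp add: f'_def)
      qed
      then show "\<lfloor>f a\<rfloor> \<le> f' a" "f' a \<le> \<lceil>f a\<rceil>" by auto
    qed
    have f'b: "f' b \<in> \<int>"
    proof -
      have "d' b = d b" "d b \<noteq> 0" using b(1) by (auto simp: D_def d'_def)
      then have "f' b = (if d b > 0 then \<lceil>f b\<rceil> else \<lfloor>f b\<rfloor>)" by (simp add: f'_def \<tau>_def)
      then show ?thesis by (simp only: Ints_of_int)
    qed
    have bF: "b \<in> A" "f b \<notin> \<int>" using b(1) by (auto simp: D_def F_def)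
    have "f' a = f a" if "f a \<in> \<int>" for a using that by (simp add: f'_def d'_def F_def)
    then have "{a\<in>A. f' a \<notin> \<int>} \<subset> {a\<in>A. f a \<notin> \<int>}" using f'b bF by auto
    then have "card {a\<in>A. f' a \<notin> \<int>} < card {a\<in>A. f a \<notin> \<int>}"
      using assms(1) by (intro psubset_card_mono) auto
    moreover have "sum f' {a\<in>A. s a = v} = sum f' {a\<in>A. t a = v}" for v
      using cons[of v] dcons[of v] by (simp add: f'_def sum.distrib flip: sum_distrib_left)
    ultimately obtain g :: "'a \<Rightarrow> int"
      where "\<forall>v. sum g {a\<in>A. s a = v} = sum g {a\<in>A. t a = v}"
        "\<forall>a\<in>A. \<lfloor>f' a\<rfloor> \<le> g a \<and> g a \<le> \<lceil>f' a\<rceil>" using less.hyps[of f'] by blast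
    moreover have "\<lfloor>f a\<rfloor> \<le> \<lfloor>f' a\<rfloor>" "\<lceil>f' a\<rceil> \<le> \<lceil>f a\<rceil>" for a
      using bounds[of a] by (auto simp: le_floor_iff ceiling_le_iff)
    ultimately show ?thesis by (meson order_trans)
  qed
qed

text \<open>The sums over the fibres of \<open>p\<close>, of the coarser \<open>c \<circ> p\<close>, and of \<open>r\<close> are the flows
  through the arcs of a network, so all of them can be rounded simultaneously.\<close>

lemma fibre_rounding:
  fixes f :: "'e \<Rightarrow> real" and p :: "'e \<Rightarrow> 'p" and c :: "'p \<Rightarrow> 'c" and r :: "'e \<Rightarrow> 'r"
  assumes "finite E"
  obtains g :: "'e \<Rightarrow> int" where
    "\<And>e. e \<in> E \<Longrightarrow> \<lfloor>f e\<rfloor> \<le> g e \<and> g e \<le> \<lceil>f e\<rceil>"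
    "\<And>y. \<lfloor>sum f {e\<in>E. p e = y}\<rfloor> \<le> sum g {e\<in>E. p e = y} \<and> sum g {e\<in>E. p e = y} \<le> \<lceil>sum f {e\<in>E. p e = y}\<rceil>"
    "\<And>z. \<lfloor>sum f {e\<in>E. c (p e) = z}\<rfloor> \<le> sum g {e\<in>E. c (p e) = z} \<and> sum g {e\<in>E. c (p e) = z} \<le> \<lceil>sum f {e\<in>E. c (p e) = z}\<rceil>"
    "\<And>x. \<lfloor>sum f {e\<in>E. r e = x}\<rfloor> \<le> sum g {e\<in>E. r e = x} \<and> sum g {e\<in>E. r e = x} \<le> \<lceil>sum f {e\<in>E. r e = x}\<rceil>"
proof -
  \<comment> \<open>The flow runs from \<open>None\<close> to the fibre \<open>z\<close> of
    \<open>c \<circ> p\<close>, on to the fibre \<open>y\<close> of \<open>p\<close>, along the arc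
    \<open>e\<close> to the fibre \<open>x\<close> of \<open>r\<close>, and back to
    \<open>None\<close>, which serves as source and sink. The arc that enters \<open>z\<close> or
    \<open>y\<close>, or leaves \<open>x\<close>, carries the sum over that fibre.\<close>
  define A :: "(('e + 'p) + ('c + 'r)) set" where "A = (E <+> p ` E) <+> (c ` p ` E <+> r ` E)"
  define s :: "('e + 'p) + ('c + 'r) \<Rightarrow> ('p + 'c + 'r) option" where
    "s = case_sum (case_sum (\<lambda>e. Some (Inl (p e))) (\<lambda>y. Some (Inr (Inl (c y)))))
                  (case_sum (\<lambda>z. None) (\<lambda>x. Some (Inr (Inr x))))"
  define t :: "('e + 'p) + ('c + 'r) \<Rightarrow> ('p + 'c + 'r) option" where
    "t = case_sum (case_sum (\<lambda>e. Some (Inr (Inr (r e)))) (\<lambda>y. Some (Inl y)))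
                  (case_sum (\<lambda>z. Some (Inr (Inl z))) (\<lambda>x. None))"
  define F where "F = case_sum (case_sum f (\<lambda>y. sum f {e\<in>E. p e = y}))
      (case_sum (\<lambda>z. sum f {e\<in>E. c (p e) = z}) (\<lambda>x. sum f {e\<in>E. r e = x}))"
  have fin: "finite A" using assms by (simp add: A_def)
  have arcs: "sum h {a\<in>A. u a = v} =
      sum (h \<circ> Inl \<circ> Inl) {e\<in>E. u (Inl (Inl e)) = v} + sum (h \<circ> Inl \<circ> Inr) {y\<in>p ` E. u (Inl (Inr y)) = v} +
      sum (h \<circ> Inr \<circ> Inl) {z\<in>c ` p ` E. u (Inr (Inl z)) = v} + sum (h \<circ> Inr \<circ> Inr) {x\<in>r ` E. u (Inr (Inr x)) = v}"
    for h :: "('e + 'p) + ('c + 'r) \<Rightarrow> 'b::comm_monoid_add" and u :: "('e + 'p) + ('c + 'r) \<Rightarrow> ('p + 'c + 'r) option" and v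
  proof -
    have "{a\<in>A. u a = v} = ({e\<in>E. u (Inl (Inl e)) = v} <+> {y\<in>p ` E. u (Inl (Inr y)) = v}) <+>
        ({z\<in>c ` p ` E. u (Inr (Inl z)) = v} <+> {x\<in>r ` E. u (Inr (Inr x)) = v})"
      unfolding A_def by force
    then show ?thesis using assms by (simp add: sum.Plus o_assoc add.assoc comp_def)
  qed
  have conserved: "\<And>v. sum F {a\<in>A. s a = v} = sum F {a\<in>A. t a = v}"
  proof -
    fix v :: "('p + 'c + 'r) option"
    have grp1: "(\<Sum>x\<in>r ` E. sum f {e\<in>E. r e = x}) = sum f E"
      by (rule sum.group) (use assms in auto)
    have grp2: "(\<Sum>z\<in>c ` p ` E. sum f {e\<in>E. c (p e) = z}) = sum f E"
      by (rule sum.group) (use assms in auto)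
    show "sum F {a\<in>A. s a = v} = sum F {a\<in>A. t a = v}"
    proof (cases v)
      case None
      then show ?thesis using grp1 grp2 by (simp add: arcs s_def t_def F_def comp_def)
    next
      case (Some w)
      show ?thesis
      proof (cases w)
        case (Inl y)
        have "{x \<in> p ` E. x = y} = (if y \<in> p ` E then {y} else {})" by auto
        then show ?thesis using Some Inl by (auto simp: arcs s_def t_def F_def comp_def intro!: sum.neutral)
      next
        case (Inr w')
        show ?thesis
        proof (cases w')
          case (Inl z)
          have "{x \<in> c ` p ` E. x = z} = (if z \<in> c ` p ` E then {z} else {})" by auto
          moreover have "(\<Sum>y\<in>{y\<in>p ` E. c y = z}. sum f {e\<in>E. p e = y}) = sum f {e\<in>E. c (p e) = z}"
          proof -
            have "(\<Sum>y\<in>{y\<in>p ` E. c y = z}. sum f {e\<in>{e\<in>E. c (p e) = z}. p e = y}) = sum f {e\<in>E. c (p e) = z}"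
              by (rule sum.group) (use assms in auto)
            moreover have "sum f {e\<in>{e\<in>E. c (p e) = z}. p e = y} = sum f {e\<in>E. p e = y}" if "c y = z" for y
              using that by (intro sum.cong) auto
            ultimately show ?thesis by simp
          qed
          ultimately show ?thesis using Some Inr Inl
            by (auto simp: arcs s_def t_def F_def comp_def intro!: sum.neutral)
        next
          case (Inr x)
          have "{x' \<in> r ` E. x' = x} = (if x \<in> r ` E then {x} else {})" by auto
          then show ?thesis using Some \<open>w = Inr w'\<close> Inr
            by (auto simp: arcs s_def t_def F_def comp_def intro!: sum.neutral)
        qed
      qed
    qed
  qed
  from circulation_rounding[OF fin this]
  obtain g where cons: "\<And>v. sum g {a\<in>A. s a = v} = sum g {a\<in>A. t a = v}"
    and bd: "\<And>a. a \<in> A \<Longrightarrow> \<lfloor>F a\<rfloor> \<le> g a \<and> g a \<le> \<lceil>F a\<rceil>"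
    by blast
  define G where "G e = g (Inl (Inl e))" for e
  have Gp: "sum G {e\<in>E. p e = y} = g (Inl (Inr y))" if "y \<in> p ` E" for y
  proof -
    have "{x \<in> p ` E. x = y} = {y}" using that by auto
    then show ?thesis using cons[of "Some (Inl y)"] by (simp add: arcs s_def t_def G_def comp_def)
  qed
  have Gc: "sum G {e\<in>E. c (p e) = z} = g (Inr (Inl z))" if "z \<in> c ` p ` E" for z
  proof -
    have "{x \<in> c ` p ` E. x = z} = {z}" using that by auto
    then have "(\<Sum>y\<in>{y\<in>p ` E. c y = z}. g (Inl (Inr y))) = g (Inr (Inl z))"
      using cons[of "Some (Inr (Inl z))"] by (simp add: arcs s_def t_def comp_def)
    moreover have "(\<Sum>y\<in>{y\<in>p ` E. c y = z}. sum G {e\<in>{e\<in>E. c (p e) = z}. p e = y}) = sum G {e\<in>E. c (p e) = z}"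
      by (rule sum.group) (use assms in auto)
    moreover have "sum G {e\<in>{e\<in>E. c (p e) = z}. p e = y} = g (Inl (Inr y))" if "y \<in> p ` E" "c y = z" for y
    proof -
      have "{e\<in>{e\<in>E. c (p e) = z}. p e = y} = {e\<in>E. p e = y}" using that by auto
      then show ?thesis using Gp that by simp
    qed
    ultimately show ?thesis by simp
  qed
  have Gr: "sum G {e\<in>E. r e = x} = g (Inr (Inr x))" if "x \<in> r ` E" for x
  proof -
    have "{x' \<in> r ` E. x' = x} = {x}" using that by auto
    then show ?thesis using cons[of "Some (Inr (Inr x))"] by (simp add: arcs s_def t_def G_def comp_def)
  qed
  have empty: "sum h {e\<in>E. q e = y} = 0" if "y \<notin> q ` E"
    for q :: "'e \<Rightarrow> 'z" and y and h :: "'e \<Rightarrow> 'b::comm_monoid_add"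
    using that by (intro sum.neutral) auto
  have empty': "sum h {e\<in>E. c (p e) = z} = 0" if "z \<notin> c ` p ` E" for z and h :: "'e \<Rightarrow> 'b::comm_monoid_add"
    using that by (intro sum.neutral) auto
  show thesis
  proof (rule that[of G])
    show "\<lfloor>f e\<rfloor> \<le> G e \<and> G e \<le> \<lceil>f e\<rceil>" if "e \<in> E" for e
      using bd[of "Inl (Inl e)"] that by (simp add: A_def F_def G_def InlI)
    show "\<lfloor>sum f {e\<in>E. p e = y}\<rfloor> \<le> sum G {e\<in>E. p e = y} \<and> sum G {e\<in>E. p e = y} \<le> \<lceil>sum f {e\<in>E. p e = y}\<rceil>" for y
      using bd[of "Inl (Inr y)"] Gp[of y] by (cases "y \<in> p ` E") (simp_all add: A_def F_def InlI InrI empty)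
    show "\<lfloor>sum f {e\<in>E. c (p e) = z}\<rfloor> \<le> sum G {e\<in>E. c (p e) = z} \<and> sum G {e\<in>E. c (p e) = z} \<le> \<lceil>sum f {e\<in>E. c (p e) = z}\<rceil>" for z
      using bd[of "Inr (Inl z)"] Gc[of z] by (cases "z \<in> c ` p ` E") (simp_all add: A_def F_def InlI InrI empty')
    show "\<lfloor>sum f {e\<in>E. r e = x}\<rfloor> \<le> sum G {e\<in>E. r e = x} \<and> sum G {e\<in>E. r e = x} \<le> \<lceil>sum f {e\<in>E. r e = x}\<rceil>" for x
      using bd[of "Inr (Inr x)"] Gr[of x] by (cases "x \<in> r ` E") (simp_all add: A_def F_def InlI InrI empty)
  qed
qed

section \<open>Linear forests\<close>

abbreviation edges :: "nat set \<Rightarrow> nat set set" where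
  "edges V \<equiv> {e. is_edge V e}"

definition deg :: "nat set multiset \<Rightarrow> nat \<Rightarrow> nat" where
  "deg G x = size (filter_mset (\<lambda>e. x \<in> e) G)"

definition path_ends :: "nat list \<Rightarrow> nat multiset" where
  "path_ends p = {#hd p, last p#}"

text \<open>The equation \<open>(\<Sum>p\<in>#Q. mset p) = mset_set V\<close> says at once that the vertex lists in \<open>Q\<close> are
  distinct, pairwise disjoint and cover \<open>V\<close>.\<close>

definition linear_forest :: "nat set \<Rightarrow> nat set multiset \<Rightarrow> bool" where
  "linear_forest V G \<longleftrightarrow> (\<exists>Q. (\<forall>p\<in>#Q. p \<noteq> []) \<and> (\<Sum>p\<in>#Q. mset p) = mset_set V \<and>
     G = (\<Sum>p\<in>#Q. path_edges p))"

lemma deg_simps [simp]: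
  "deg {#} x = 0" "deg (add_mset e G) x = of_bool (x \<in> e) + deg G x" "deg (G + H) x = deg G x + deg H x"
  by (auto simp: deg_def)

lemma deg_sum_mset: "deg (\<Sum>p\<in>#Q. f p) x = (\<Sum>p\<in>#Q. deg (f p) x)"
  by (induction Q) auto

lemma path_edges_simps [simp]:
  "path_edges [] = {#}" "path_edges [a] = {#}"
  "path_edges (a # b # r) = add_mset {a, b} (path_edges (b # r))"
proof -
  have "[0..<Suc (length r)] = 0 # map Suc [0..<length r]"
    by (simp only: map_Suc_upt upt_conv_Cons zero_less_Suc One_nat_def)
  then show "path_edges (a # b # r) = add_mset {a, b} (path_edges (b # r))"
    unfolding path_edges_def by (simp add: comp_def del: upt_Suc)
qed (auto simp: path_edges_def)

lemma path_edges_append: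
  "p \<noteq> [] \<Longrightarrow> q \<noteq> [] \<Longrightarrow>
    path_edges (p @ q) = add_mset {last p, hd q} (path_edges p + path_edges q)"
proof (induction p rule: induct_list012)
  case (2 a)
  then show ?case by (cases q) auto
qed auto

lemma path_edges_rev: "path_edges (rev p) = path_edges p"
proof (induction p rule: induct_list012)
  case (3 a b r)
  have "path_edges (rev (a # b # r)) = path_edges (rev (b # r) @ [a])" by simp
  also have "\<dots> = add_mset {last (rev (b # r)), a} (path_edges (rev (b # r)))"
    by (subst path_edges_append) auto
  finally show ?case using 3 by (simp add: insert_commute)
qed auto

lemma size_path_edges [simp]: "size (path_edges p) = length p - 1"
  by (simp add: path_edges_def)

lemma path_edges_is_edge:
  "distinct p \<Longrightarrow> e \<in># path_edges p \<Longrightarrow> is_edge (set p) e"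
  by (induction p rule: induct_list012) (auto simp: is_edge_def card_insert_if)

lemma count_path_edges_le: "distinct p \<Longrightarrow> count (path_edges p) e \<le> 1"
proof (induction p rule: induct_list012)
  case (3 a b r)
  have "count (path_edges (b # r)) {a, b} = 0"
    using path_edges_is_edge[of "b # r" "{a, b}"] 3(3) by (auto simp: is_edge_def count_eq_zero_iff)
  then show ?case using 3 by auto
qed auto

text \<open>An inner vertex has degree 2, a proper end has degree 1, and the vertex of a trivial
  path has degree 0 but is listed as an end twice.\<close>

lemma path_ends_deg:
  "distinct p \<Longrightarrow> p \<noteq> [] \<Longrightarrow> count (path_ends p) x + deg (path_edges p) x = 2 * count (mset p) x"
proof (induction p rule: induct_list012)
  case (3 a b r)
  then have "count (path_ends (b # r)) x + deg (path_edges (b # r)) x = 2 * count (mset (b # r)) x"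
    by simp
  then show ?case using 3(3) by (auto simp: path_ends_def split: if_splits)
qed (auto simp: path_ends_def)

lemma cycle_edges_eq: "vs \<noteq> [] \<Longrightarrow> cycle_edges vs = add_mset {last vs, hd vs} (path_edges vs)"
proof -
  assume "vs \<noteq> []"
  then obtain l where l: "length vs = Suc l" by (cases vs) auto
  have "map (\<lambda>i. {vs ! i, vs ! (Suc i mod Suc l)}) [0..<l] = map (\<lambda>i. {vs ! i, vs ! Suc i}) [0..<l]"
    by (intro map_cong) auto
  moreover have "vs ! l = last vs" "vs ! 0 = hd vs"
    using l \<open>vs \<noteq> []\<close> by (simp_all add: last_conv_nth hd_conv_nth)
  ultimately show ?thesis unfolding cycle_edges_def path_edges_def
    unfolding l by (simp del: mset_map map_eq_conv)
qed

lemma is_cycle_hd_last: "is_cycle vs \<Longrightarrow> distinct vs \<and> vs \<noteq> [] \<and> hd vs \<noteq> last vs"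
proof -
  assume vs: "is_cycle vs"
  then obtain a b r where "vs = a # b # r"
    by (cases vs; cases "tl vs") (auto simp: is_cycle_def)
  moreover have "last (b # r) \<in> set (b # r)" by (rule last_in_set) simp
  ultimately show ?thesis using vs by (auto simp: is_cycle_def)
qed

lemma deg_cycle_edges:
  assumes "is_cycle vs" "x \<in> set vs"
  shows "deg (cycle_edges vs) x = 2"
proof -
  have vs: "distinct vs" "vs \<noteq> []" "hd vs \<noteq> last vs"
    using is_cycle_hd_last assms by auto
  then show ?thesis
    using path_ends_deg[of vs x] assms(2) by (auto simp: cycle_edges_eq path_ends_def count_mset_0_iff distinct_count_atmost_1 split: if_splits)
qed

text \<open>With three or more vertices the first and the last are not consecutive on the path, so
  the closing edge is new. For two vertices the cycle is a double edge.\<close>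

lemma count_cycle_edges_le:
  assumes "distinct vs" "length vs \<ge> 3"
  shows "count (cycle_edges vs) e \<le> 1"
proof -
  obtain a b r where vs: "vs = a # b # r" "r \<noteq> []"
    using assms(2) by (cases vs; cases "tl vs"; cases "tl (tl vs)") auto
  have "last r \<in> set r" using vs by simp
  have "{last r, a} \<notin># path_edges (b # r)"
    using path_edges_is_edge[of "b # r" "{last r, a}"] vs assms(1) by (auto simp: is_edge_def)
  moreover have "{last r, a} \<noteq> {a, b}" using vs assms(1) \<open>last r \<in> set r\<close> by (auto simp: doubleton_eq_iff)
  ultimately have "count (path_edges vs) {last vs, hd vs} = 0"
    unfolding count_eq_zero_iff using vs by (metis insert_iff last_ConsR list.discI list.sel(1) path_edges_simps(3) set_mset_add_mset_insert)
  moreover have "vs \<noteq> []" using vs by simp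
  ultimately show ?thesis using count_path_edges_le[OF assms(1), of e]
    by (cases "{last vs, hd vs} = e") (simp_all only: cycle_edges_eq count_add_mset if_True if_False order_refl simp_thms One_nat_def)
qed

lemma size_cycle_edges [simp]: "size (cycle_edges vs) = length vs"
  by (simp add: cycle_edges_def)

lemma cycle_edges_is_edge:
  assumes "is_cycle vs" "e \<in># cycle_edges vs"
  shows "is_edge (set vs) e"
proof -
  have vs: "distinct vs" "vs \<noteq> []" "hd vs \<noteq> last vs"
    using is_cycle_hd_last assms by auto
  then show ?thesis using assms(2) path_edges_is_edge[OF vs(1), of e]
    by (auto simp: cycle_edges_eq is_edge_def)
qed

lemma mset_cover_distinct:
  assumes "(\<Sum>p\<in>#Q. mset p) = mset_set V" "p \<in># Q"
  shows "distinct p"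
proof -
  have "mset p \<subseteq># mset_set V" using assms
    by (metis insert_DiffM mset_subset_eq_add_left sum_mset.add_mset image_mset_add_mset)
  then have "count (mset p) x \<le> 1" for x
    using mset_subset_eq_count[of "mset p" "mset_set V" x] by (simp add: count_mset_set' le_trans split: if_splits)
  then show ?thesis by (simp add: distinct_count_atmost_1 count_mset_0_iff) (metis One_nat_def count_mset_0_iff le_Suc_eq le_zero_eq)
qed

text \<open>This converts degrees, which the decomposition determines, into numbers of path ends,
  which are what a new vertex is joined to.\<close>

lemma linear_forest_ends:
  assumes "\<forall>p\<in>#Q. p \<noteq> []" "(\<Sum>p\<in>#Q. mset p) = mset_set V" "finite V"
  shows "(\<Sum>p\<in>#Q. count (path_ends p) x) + deg (\<Sum>p\<in>#Q. path_edges p) x = 2 * of_bool (x \<in> V)"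
proof -
  have "(\<Sum>p\<in>#Q. count (path_ends p) x) + deg (\<Sum>p\<in>#Q. path_edges p) x =
     (\<Sum>p\<in>#Q. count (path_ends p) x + deg (path_edges p) x)"
    by (simp add: sum_mset.distrib deg_sum_mset)
  also have "\<dots> = (\<Sum>p\<in>#Q. 2 * count (mset p) x)"
    using mset_cover_distinct[OF assms(2)] assms(1) path_ends_deg
    by (intro arg_cong[where f = sum_mset] image_mset_cong) auto
  also have "\<dots> = 2 * count (\<Sum>p\<in>#Q. mset p) x"
    by (induction Q) auto
  finally show ?thesis using assms by (simp add: count_mset_set')
qed

text \<open>Every path has one vertex more than it has edges. A lower bound on the edges of a class
  is thereby an upper bound on the number of its paths.\<close>

lemma linear_forest_size:
  assumes "\<forall>p\<in>#Q. p \<noteq> []" "(\<Sum>p\<in>#Q. mset p) = mset_set V"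
  shows "size (\<Sum>p\<in>#Q. path_edges p) + size Q = card V"
proof -
  have "size (\<Sum>p\<in>#Q. path_edges p) + size Q = size (\<Sum>p\<in>#Q. mset p)"
    using assms(1) by (induction Q) (auto simp: neq_Nil_conv)
  then show ?thesis using assms(2) by simp
qed

lemma linear_forest_is_edge:
  assumes "linear_forest V G" "finite V" "e \<in># G"
  shows "is_edge V e"
proof -
  obtain Q where Q: "\<forall>p\<in>#Q. p \<noteq> []" "(\<Sum>p\<in>#Q. mset p) = mset_set V" "G = (\<Sum>p\<in>#Q. path_edges p)"
    using assms by (auto simp: linear_forest_def)
  then obtain p where p: "p \<in># Q" "e \<in># path_edges p" using assms(3) by auto
  have "set p \<subseteq> V"
  proof
    fix x assume "x \<in> set p"
    then have "x \<in># (\<Sum>p\<in>#Q. mset p)" using p by auto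
    then show "x \<in> V" using assms(2) Q(2) by simp
  qed
  then show ?thesis
    using path_edges_is_edge[OF mset_cover_distinct[OF Q(2) p(1)] p(2)] by (auto simp: is_edge_def)
qed

lemma linear_forest_empty: "finite V \<Longrightarrow> linear_forest V {#}"
proof -
  assume "finite V"
  have "(\<Sum>p\<in>#image_mset (\<lambda>x. [x]) (mset_set V). mset p) = mset_set V"
    by (simp add: comp_def multiset.map_comp)
  then show ?thesis unfolding linear_forest_def
    by (intro exI[of _ "image_mset (\<lambda>x. [x]) (mset_set V)"]) (auto simp: multiset.map_comp comp_def)
qed

section \<open>Adding and removing edges of linear forests\<close>

lemma linear_forest_join:
  assumes Q: "\<forall>p\<in>#Q. p \<noteq> []" "p \<noteq> []" "q \<noteq> []"
    and V: "mset p + mset q + (\<Sum>p\<in>#Q. mset p) = mset_set V"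
    and ends: "u \<in># path_ends p" "v \<in># path_ends q"
  shows "linear_forest V (add_mset {u, v} (path_edges p + path_edges q + (\<Sum>p\<in>#Q. path_edges p)))"
proof -
  \<comment> \<open>Reversal, where necessary, puts \<open>u\<close> last in its list and
    \<open>v\<close> first in the other, so that concatenation creates the edge between
    them.\<close>
  define p' where "p' = (if last p = u then p else rev p)"
  define q' where "q' = (if hd q = v then q else rev q)"
  have p': "last p' = u" "mset p' = mset p" "path_edges p' = path_edges p" "p' \<noteq> []"
    using ends Q by (auto simp: p'_def path_ends_def path_edges_rev last_rev)
  have q': "hd q' = v" "mset q' = mset q" "path_edges q' = path_edges q" "q' \<noteq> []"
    using ends Q by (auto simp: q'_def path_ends_def path_edges_rev hd_rev)
  show ?thesis unfolding linear_forest_def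
    using p' q' Q V by (intro exI[of _ "add_mset (p' @ q') Q"]) (auto simp: path_edges_append)
qed

lemma path_end_of_component:
  assumes Q: "\<forall>p\<in>#Q. p \<noteq> []" "(\<Sum>p\<in>#Q. mset p) = mset_set V" "finite V"
    and "x \<in> V" "deg (\<Sum>p\<in>#Q. path_edges p) x \<le> 1"
  obtains p where "p \<in># Q" "x \<in># path_ends p"
proof -
  have "2 * of_bool (x \<in> V) = (2::nat)" using \<open>x \<in> V\<close> by simp
  then have "(\<Sum>p\<in>#Q. count (path_ends p) x) \<noteq> 0"
    using linear_forest_ends[OF Q, of x] assms(5) by linarith
  then have "\<exists>p\<in>#Q. count (path_ends p) x \<noteq> 0" by (rule contrapos_np) (simp add: count_eq_zero_iff)
  then obtain p where "p \<in># Q" "count (path_ends p) x \<noteq> 0" by blast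
  then show ?thesis using that by (meson count_eq_zero_iff)
qed

lemma linear_forest_add_ends:
  assumes Q: "\<forall>p\<in>#Q. p \<noteq> []" "(\<Sum>p\<in>#Q. mset p) = mset_set V"
    and pq: "p \<in># Q" "q \<in># Q" "p \<noteq> q" "u \<in># path_ends p" "v \<in># path_ends q"
  shows "linear_forest V (add_mset {u, v} (\<Sum>p\<in>#Q. path_edges p))"
proof -
  obtain Q' where Q': "Q = add_mset p (add_mset q Q')"
    using pq by (metis insert_noteq_member mset_add)
  show ?thesis using linear_forest_join[of Q' p q V u v] Q pq
    unfolding Q' by (simp add: add.assoc)
qed

lemma mset_cover_disjoint:
  assumes "(\<Sum>p\<in>#Q. mset p) = mset_set V" "p \<in># Q" "q \<in># Q" "x \<in> set p" "x \<in> set q"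
  shows "p = q"
proof (rule ccontr)
  assume "p \<noteq> q"
  then obtain Q' where Q': "Q = add_mset p (add_mset q Q')"
    using assms by (metis insert_noteq_member mset_add)
  have "count (mset_set V) x \<ge> count (mset p) x + count (mset q) x"
    unfolding assms(1)[symmetric] Q' by simp
  moreover have "count (mset p) x \<ge> 1" "count (mset q) x \<ge> 1" using assms(4,5)
    by (simp_all add: Suc_leI count_mset_gt_0 flip: One_nat_def) 
  moreover have "count (mset_set V) x \<le> 1" by (simp add: count_mset_set')
  ultimately show False by linarith
qed

lemma path_ends_subset: "p \<noteq> [] \<Longrightarrow> x \<in># path_ends p \<Longrightarrow> x \<in> set p"
  by (auto simp: path_ends_def)

text \<open>By \<open>path_ends_deg\<close> a vertex of degree 0 is both ends of its path, and a
  distinct list with equal first and last entry has length 1.\<close>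

lemma singleton_component:
  assumes Q: "\<forall>p\<in>#Q. p \<noteq> []" "(\<Sum>p\<in>#Q. mset p) = mset_set V" "finite V"
    and "p \<in># Q" "x \<in># path_ends p" "deg (\<Sum>p\<in>#Q. path_edges p) x = 0"
  shows "p = [x]"
proof -
  have "deg (path_edges p) x = 0"
    using assms(4,6) by (auto simp: deg_sum_mset sum_mset_0_iff)
  moreover have d: "distinct p" using mset_cover_distinct[OF Q(2) assms(4)] .
  moreover have "p \<noteq> []" "x \<in> set p" using assms path_ends_subset by auto
  moreover have "count (mset p) x = 1" using d \<open>x \<in> set p\<close> by (simp add: distinct_count_atmost_1)
  ultimately have "count (path_ends p) x = 2" using path_ends_deg[of p x] by simp
  then have "hd p = x" "last p = x" by (auto simp: path_ends_def split: if_splits)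
  then show ?thesis using d \<open>p \<noteq> []\<close>
    by (cases p) (auto split: if_splits)
qed

text \<open>Both vertices are path ends and one of them is isolated, so they lie on different paths.
  Two ends of degree 1 might belong to the same path, which the new edge would close to a
  cycle.\<close>

lemma linear_forest_add_edge:
  assumes G: "linear_forest V G" "finite V" and uv: "u \<in> V" "v \<in> V" "u \<noteq> v"
    and deg: "deg G u + deg G v \<le> 1"
  shows "linear_forest V (add_mset {u, v} G)"
proof -
  obtain Q where Q: "\<forall>p\<in>#Q. p \<noteq> []" "(\<Sum>p\<in>#Q. mset p) = mset_set V" "G = (\<Sum>p\<in>#Q. path_edges p)"
    using G by (auto simp: linear_forest_def)
  obtain p where p: "p \<in># Q" "u \<in># path_ends p"
    using path_end_of_component[OF Q(1,2) G(2) uv(1)] deg Q(3) by (metis add_leD1)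
  obtain q where q: "q \<in># Q" "v \<in># path_ends q"
    using path_end_of_component[OF Q(1,2) G(2) uv(2)] deg Q(3) by (metis add_leD2)
  have "p \<noteq> q"
  proof
    assume "p = q"
    consider "deg G u = 0" | "deg G v = 0" using deg by linarith
    then show False
    proof cases
      case 1
      then have "p = [u]" using singleton_component[OF Q(1,2) G(2) p] Q(3) by simp
      then show False using q \<open>p = q\<close> uv by (simp add: path_ends_def)
    next
      case 2
      then have "q = [v]" using singleton_component[OF Q(1,2) G(2) q] Q(3) by simp
      then show False using p \<open>p = q\<close> uv by (simp add: path_ends_def)
    qed
  qed
  then show ?thesis using linear_forest_add_ends[OF Q(1,2) p(1) q(1) _ p(2) q(2)] Q(3) by simp
qed

text \<open>The path with end \<open>u\<close> also has \<open>x\<close> as an end, since both have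
  degree at most 1 and are adjacent. Hence \<open>v\<close> is an end of another path. This covers a
  situation in which \<open>u\<close> and \<open>v\<close> may both have degree 1.\<close>

lemma linear_forest_add_edge_isolated:
  assumes G: "linear_forest V G" "finite V" and V: "u \<in> V" "v \<in> V" "v \<notin> {u, x}"
    and ux: "{u, x} \<in># G" "u \<noteq> x" "deg G u \<le> 1" "deg G x \<le> 1" and v: "deg G v \<le> 1"
  shows "linear_forest V (add_mset {u, v} G)"
proof -
  obtain Q where Q: "\<forall>p\<in>#Q. p \<noteq> []" "(\<Sum>p\<in>#Q. mset p) = mset_set V" "G = (\<Sum>p\<in>#Q. path_edges p)"
    using G by (auto simp: linear_forest_def)
  obtain p where p: "p \<in># Q" "u \<in># path_ends p"
    using path_end_of_component[OF Q(1,2) G(2) V(1)] ux Q(3) by metis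
  obtain q where q: "q \<in># Q" "v \<in># path_ends q"
    using path_end_of_component[OF Q(1,2) G(2) V(2)] v Q(3) by metis
  have "x \<in> V" using linear_forest_is_edge[OF G ux(1)] by (simp add: is_edge_def)
  then obtain p' where p': "p' \<in># Q" "x \<in># path_ends p'"
    using path_end_of_component[OF Q(1,2) G(2)] ux Q(3) by metis
  have "p \<noteq> q"
  proof
    assume "p = q"
    obtain r where r: "r \<in># Q" "{u, x} \<in># path_edges r" using ux(1) Q(3) by auto
    have "{u, x} \<subseteq> set r"
      using path_edges_is_edge[OF mset_cover_distinct[OF Q(2) r(1)] r(2)] by (simp add: is_edge_def)
    then have "r = p" "r = p'"
      using mset_cover_disjoint[OF Q(2) r(1)] p p' path_ends_subset Q(1)
      by (metis insert_subset)+
    then have "u \<in># path_ends p" "x \<in># path_ends p" "v \<in># path_ends p"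
      using p p' q \<open>p = q\<close> by auto
    then show False using ux(2) V(3) by (auto simp: path_ends_def)
  qed
  then show ?thesis using linear_forest_add_ends[OF Q(1,2) p(1) q(1) _ p(2) q(2)] Q(3) by simp
qed

lemma path_edges_split:
  assumes "e \<in># path_edges p"
  obtains p1 p2 where "p = p1 @ p2" "p1 \<noteq> []" "p2 \<noteq> []" "e = {last p1, hd p2}"
proof -
  have "\<exists>p1 p2. p = p1 @ p2 \<and> p1 \<noteq> [] \<and> p2 \<noteq> [] \<and> e = {last p1, hd p2}"
    using assms
  proof (induction p rule: induct_list012)
    case (3 a b r)
    show ?case
    proof (cases "e = {a, b}")
      case True
      then show ?thesis by (intro exI[of _ "[a]"] exI[of _ "b # r"]) auto
    next
      case False
      then obtain p1 p2 where "b # r = p1 @ p2" "p1 \<noteq> []" "p2 \<noteq> []" "e = {last p1, hd p2}"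
        using 3 by auto
      then show ?thesis by (intro exI[of _ "a # p1"] exI[of _ p2]) auto
    qed
  qed auto
  then show ?thesis using that by blast
qed

lemma linear_forest_remove_edge:
  assumes "linear_forest V (add_mset e G)"
  shows "linear_forest V G"
proof -
  obtain Q where Q: "\<forall>p\<in>#Q. p \<noteq> []" "(\<Sum>p\<in>#Q. mset p) = mset_set V" "add_mset e G = (\<Sum>p\<in>#Q. path_edges p)"
    using assms by (auto simp: linear_forest_def)
  have "e \<in># (\<Sum>p\<in>#Q. path_edges p)" unfolding Q(3)[symmetric] by simp
  then obtain p where p: "p \<in># Q" "e \<in># path_edges p" by auto
  obtain p1 p2 where s: "p = p1 @ p2" "p1 \<noteq> []" "p2 \<noteq> []" "e = {last p1, hd p2}"
    using path_edges_split[OF p(2)] .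
  obtain Q' where Q': "Q = add_mset p Q'" using p(1) by (metis mset_add)
  have "G = (\<Sum>p\<in>#add_mset p1 (add_mset p2 Q'). path_edges p)"
    using Q(3) s unfolding Q' by (simp add: path_edges_append add.assoc)
  moreover have "(\<Sum>p\<in>#add_mset p1 (add_mset p2 Q'). mset p) = mset_set V"
    using Q(2) s unfolding Q' by (simp add: add.assoc)
  ultimately show ?thesis unfolding linear_forest_def using Q(1) s Q' 
    by (intro exI[of _ "add_mset p1 (add_mset p2 Q')"]) auto
qed

text \<open>A path does not repeat an edge, and a second copy on another path would make the two
  share vertices.\<close>

lemma linear_forest_count_le:
  assumes "linear_forest V G"
  shows "count G e \<le> 1"
proof (rule ccontr)
  assume "\<not> ?thesis"
  then have "count G e \<ge> 2" by simp
  then obtain G' where G': "G = add_mset e (add_mset e G')"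
    by (metis Suc_1 count_add_mset count_greater_eq_one_iff insert_DiffM le_SucI le_add1 mset_add nat_less_le plus_1_eq_Suc count_eq_zero_iff Suc_le_mono)
  obtain Q where Q: "\<forall>p\<in>#Q. p \<noteq> []" "(\<Sum>p\<in>#Q. mset p) = mset_set V" "G = (\<Sum>p\<in>#Q. path_edges p)"
    using assms by (auto simp: linear_forest_def)
  have "e \<in># (\<Sum>p\<in>#Q. path_edges p)" unfolding Q(3)[symmetric] G' by simp
  then obtain p where p: "p \<in># Q" "e \<in># path_edges p" by auto
  have d: "distinct p" using mset_cover_distinct[OF Q(2) p(1)] .
  obtain Q' where Q': "Q = add_mset p Q'" using p(1) by (metis mset_add)
  have "count (\<Sum>p\<in>#Q'. path_edges p) e > 0"
    using \<open>count G e \<ge> 2\<close> count_path_edges_le[OF d, of e] unfolding Q(3) Q'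
    by (simp only: image_mset_add_mset sum_mset.add_mset count_union)
  then have "e \<in># (\<Sum>p\<in>#Q'. path_edges p)" by (simp only: count_greater_zero_iff)
  then obtain q where q: "q \<in># Q'" "e \<in># path_edges q" by auto
  have e: "is_edge (set p) e" "is_edge (set q) e"
    using path_edges_is_edge p q d mset_cover_distinct[OF Q(2), of q] Q' by auto
  then obtain x where x: "x \<in> set p" "x \<in> set q" by (fastforce simp: is_edge_def card_2_iff)
  obtain Q'' where Q'': "Q' = add_mset q Q''" using q(1) by (metis mset_add)
  have "count (mset_set V) x \<ge> count (mset p) x + count (mset q) x"
    unfolding Q(2)[symmetric] Q' Q'' by simp
  moreover have "count (mset p) x \<ge> 1" "count (mset q) x \<ge> 1" using x
    by (simp_all add: Suc_leI count_mset_gt_0 flip: One_nat_def) 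
  moreover have "count (mset_set V) x \<le> 1" by (simp add: count_mset_set')
  ultimately show False by linarith
qed

section \<open>Assignments with capacities\<close>

text \<open>A Hall-type statement: \<open>f\<close> is tight if its \<open>s f\<close> requests can only be served by all the
  remaining capacity outside \<open>f\<close>; the pair chosen in each step has to hit every tight \<open>f\<close>.\<close>

lemma avoiding_assignment:
  fixes g :: "'i \<Rightarrow> 'e" and a :: "'e \<Rightarrow> nat"
  assumes "finite E" "finite I"
    and "card I \<le> sum a E"
    and "\<And>f. f \<in> E \<Longrightarrow> card {i\<in>I. g i = f} \<le> sum a (E - {f})"
  shows "\<exists>h. (\<forall>i\<in>I. h i \<in> E \<and> h i \<noteq> g i) \<and> (\<forall>f\<in>E. card {i\<in>I. h i = f} \<le> a f)"
  using assms(2-4)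
proof (induction "card I" arbitrary: I a)
  case 0
  then show ?case by auto
next
  case (Suc l)
  note finE = assms(1) and finI = Suc.prems(1)
  define s where "s f = card {i\<in>I. g i = f}" for f
  define T where "T = sum a E"
  have T: "card I \<le> T" "T > 0" using Suc.prems(2) Suc.hyps(2) by (auto simp: T_def)
  have rem: "sum a (E - {f}) + a f = T" if "f \<in> E" for f
    using that finE by (simp add: T_def sum.remove)
  have rem2: "a f + a f' \<le> T" if "f \<in> E" "f' \<in> E" "f \<noteq> f'" for f f'
    using rem[OF that(1)] member_le_sum[of f' "E - {f}" a] that finE by auto
  have rem3: "a f + a f' + a f'' \<le> T" if "f \<in> E" "f' \<in> E" "f'' \<in> E" "f \<noteq> f'" "f \<noteq> f''" "f' \<noteq> f''" for f f' f''
  proof -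
    have "sum a {f, f', f''} \<le> sum a E" using that finE by (intro sum_mono2) auto
    then show ?thesis using that by (simp add: T_def)
  qed
  have s: "s f + a f \<le> T" if "f \<in> E" for f
    using Suc.prems(3)[OF that] rem[OF that] by (simp add: s_def)
  have s2: "s f + s f' \<le> card I" if "f \<noteq> f'" for f f'
  proof -
    have "s f + s f' = card ({i\<in>I. g i = f} \<union> {i\<in>I. g i = f'})"
      unfolding s_def using finI that by (intro card_Un_disjoint[symmetric]) auto
    also have "\<dots> \<le> card I" using finI by (intro card_mono) auto
    finally show ?thesis .
  qed
  have spos: "s (g i) > 0" if "i \<in> I" for i using that finI by (auto simp: s_def card_gt_0_iff)
  have avail: "\<exists>f'\<in>E. f' \<noteq> f \<and> a f' > 0" if "sum a (E - {f}) > 0" for f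
  proof (rule ccontr)
    assume "\<not> ?thesis"
    then have "sum a (E - {f}) = 0" by (intro sum.neutral) auto
    then show False using that by simp
  qed
  obtain i f where i: "i \<in> I" and f: "f \<in> E" "f \<noteq> g i" "a f > 0"
    and tight: "\<And>h. h \<in> E \<Longrightarrow> s h + a h = T \<Longrightarrow> h = g i \<or> h = f"
  proof -
    consider (none) "\<forall>h\<in>E. s h + a h \<noteq> T"
      | (pos) t where "t \<in> E" "s t + a t = T" "s t > 0"
      | (zero) t where "t \<in> E" "s t + a t = T" "s t = 0" by blast
    then show thesis
    proof cases
      case none
      obtain i where i: "i \<in> I" using Suc.hyps(2) by (metis card_eq_0_iff ex_in_conv nat.distinct(1))
      have "sum a (E - {g i}) > 0"
      proof (cases "g i \<in> E")
        case True
        then show ?thesis using s[OF True] rem[OF True] spos[OF i] by linarith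
      next
        case False
        then show ?thesis using T by (simp add: T_def)
      qed
      then obtain f where "f \<in> E" "f \<noteq> g i" "a f > 0" using avail by blast
      then show thesis using that[OF i] none by blast
    next
      \<comment> \<open>Serving a request that forbids \<open>t\<close> lowers \<open>s t\<close>,
        so \<open>t\<close> is taken care of. For a second tight \<open>h\<close> the requests give
        \<open>s t + s h \<le> card I \<le> T\<close>, hence \<open>a t + a h \<ge> T\<close>: all
        capacity sits at \<open>t\<close> and \<open>h\<close>, and any usable \<open>f\<close>
        other than \<open>t\<close> is \<open>h\<close> itself.\<close>
      case pos
      then obtain i where i: "i \<in> I" "g i = t" by (auto simp: s_def card_gt_0_iff)
      have "sum a (E - {t}) > 0" using rem[OF pos(1)] pos by linarith
      then obtain f where f: "f \<in> E" "f \<noteq> t" "a f > 0" using avail by blast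
      have "h = t \<or> h = f" if "h \<in> E" "s h + a h = T" for h
      proof (rule ccontr)
        assume "\<not> ?thesis"
        then have "h \<noteq> t" "h \<noteq> f" by auto
        then have "a t + a h + a f \<le> T" "s t + s h \<le> card I"
          using rem3[of t h f] s2[of t h] pos(1) that(1) f by auto
        then show False using that(2) pos(2) f(3) T by linarith
      qed
      then show thesis using that[OF i(1) f(1)] f i by blast
    next
      \<comment> \<open>Here the whole capacity sits at \<open>t\<close>, so \<open>t\<close> must
        be the value used. A second tight \<open>h\<close> has no capacity and is forbidden by every
        request, in particular by \<open>i\<close>.\<close>
      case zero
      obtain i where i: "i \<in> I" using Suc.hyps(2) by (metis card_eq_0_iff ex_in_conv nat.distinct(1))
      have gi: "g i \<noteq> t" using spos[OF i] zero by auto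
      have "h = g i \<or> h = t" if "h \<in> E" "s h + a h = T" for h
      proof (rule ccontr)
        assume "\<not> ?thesis"
        then have "h \<noteq> t" "h \<noteq> g i" by auto
        then have "a t + a h \<le> T" "s h + s (g i) \<le> card I"
          using rem2[of t h] s2[of h "g i"] zero(1) that(1) by auto
        then show False using that(2) zero T spos[OF i] by linarith
      qed
      then show thesis using that[OF i zero(1)] gi zero T by auto
    qed
  qed
  define I' where "I' = I - {i}"
  define a' where "a' = a(f := a f - 1)"
  have finI': "finite I'" and cardI': "card I' = l" "l = card I'"
    using i finI Suc.hyps(2) by (auto simp: I'_def)
  have a': "sum a' (E - {h}) + of_bool (f \<noteq> h) = sum a (E - {h})" for h
  proof (cases "f = h")
    case True
    then have "sum a' (E - {h}) = sum a (E - {h})" by (intro sum.cong) (auto simp: a'_def)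
    then show ?thesis using True by simp
  next
    case False
    then have mem: "f \<in> E - {h}" "finite (E - {h})" using f finE by auto
    have "sum a' (E - {h} - {f}) = sum a (E - {h} - {f})"
      by (intro sum.cong) (auto simp: a'_def)
    then show ?thesis using False f(3) sum.remove[OF mem(2,1), of a] sum.remove[OF mem(2,1), of a']
      by (simp add: a'_def)
  qed
  have "sum a E = sum a' E + 1"
  proof -
    have "sum a' (E - {f}) = sum a (E - {f})" using a'[of f] by simp
    then show ?thesis using f(3) sum.remove[OF finE f(1), of a] sum.remove[OF finE f(1), of a']
      by (simp add: a'_def)
  qed
  then have c1: "card I' \<le> sum a' E" using T cardI' Suc.hyps(2) by (simp add: T_def)
  have c2: "card {i\<in>I'. g i = h} \<le> sum a' (E - {h})" if h: "h \<in> E" for h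
  proof -
    have sub: "card {i\<in>I'. g i = h} + of_bool (g i = h) = s h"
    proof (cases "g i = h")
      case True
      then have "{i\<in>I. g i = h} = insert i {i\<in>I'. g i = h}" using i by (auto simp: I'_def)
      moreover have "i \<notin> {i\<in>I'. g i = h}" by (simp add: I'_def)
      ultimately show ?thesis using True finI' by (simp add: s_def)
    next
      case False
      then have "{i\<in>I. g i = h} = {i\<in>I'. g i = h}" by (auto simp: I'_def)
      then show ?thesis using False by (simp add: s_def)
    qed
    consider "h = f" | "h = g i" "h \<noteq> f" | "h \<noteq> f" "h \<noteq> g i" by auto
    then show ?thesis
    proof cases
      case 3
      then have "s h + a h < T" using tight[OF h] s[OF h] by linarith
      then show ?thesis using 3 sub a'[of h] rem[OF h] by simp
    qed (use sub a'[of h] s[OF h] rem[OF h] f in auto)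
  qed
  obtain h where h: "\<forall>i\<in>I'. h i \<in> E \<and> h i \<noteq> g i" "\<forall>f\<in>E. card {i\<in>I'. h i = f} \<le> a' f"
    using Suc.hyps(1)[OF cardI'(2) finI' c1 c2] by blast
  define h' where "h' = h(i := f)"
  have "card {i\<in>I. h' i = e} \<le> a e" if e: "e \<in> E" for e
  proof (cases "e = f")
    case True
    then have "{j\<in>I. h' j = e} = insert i {j\<in>I'. h j = e}" using i by (auto simp: I'_def h'_def)
    then have "card {j\<in>I. h' j = e} \<le> Suc (card {j\<in>I'. h j = e})" by (simp add: card_insert_le_m1 card_insert_if finI')
    also have "\<dots> \<le> a e" using h(2) e True f(3) by (force simp: a'_def)
    finally show ?thesis .
  next
    case False
    then have "{j\<in>I. h' j = e} = {j\<in>I'. h j = e}" by (auto simp: I'_def h'_def)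
    then show ?thesis using h(2) e False by (auto simp: a'_def)
  qed
  moreover have "\<forall>i\<in>I. h' i \<in> E \<and> h' i \<noteq> g i" using h(1) f by (auto simp: h'_def I'_def)
  ultimately show ?case by blast
qed

text \<open>The avoiding version with \<open>None\<close> as forbidden value for every index; it
  lies outside the image of \<open>Some\<close> and so forbids nothing.\<close>

lemma capacity_assignment:
  assumes "finite E" "finite I" "card I \<le> sum a E"
  shows "\<exists>h. (\<forall>i\<in>I. h i \<in> E) \<and> (\<forall>f\<in>E. card {i\<in>I. h i = f} \<le> a f)"
proof -
  have "\<exists>h. (\<forall>i\<in>I. h i \<in> Some ` E \<and> h i \<noteq> None) \<and> (\<forall>f\<in>Some ` E. card {i\<in>I. h i = f} \<le> (a \<circ> the) f)"
    using assms by (intro avoiding_assignment) (auto simp: sum.reindex)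
  then obtain h where h: "\<forall>i\<in>I. h i \<in> Some ` E" "\<forall>f\<in>E. card {i\<in>I. h i = Some f} \<le> a f"
    by auto
  have "{i\<in>I. the (h i) = f} = {i\<in>I. h i = Some f}" for f using h(1) by auto
  then show ?thesis using h by (intro exI[of _ "the \<circ> h"]) auto
qed

section \<open>Counting edges in decompositions\<close>

text \<open>The components witnessing \<open>paths_and_cycles\<close> need not cover
  \<open>V\<close>, and their trivial paths may even lie outside \<open>V\<close>. They are
  therefore discarded, and each vertex of \<open>V\<close> on no remaining path is put back as a
  trivial path. Cycles are excluded since each component is contained in \<open>G\<close>.\<close>

lemma strong_imp_linear_forest:
  assumes "paths_and_cycles G" "\<not> contains_cycle G" "\<And>e. e \<in># G \<Longrightarrow> is_edge V e" "finite V"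
  shows "linear_forest V G"
proof -
  obtain cs where ok: "\<And>c. c \<in> set cs \<Longrightarrow> comp_ok c"
    and disj: "\<And>i j. i < j \<Longrightarrow> j < length cs \<Longrightarrow> set (snd (cs ! i)) \<inter> set (snd (cs ! j)) = {}"
    and G: "G = sum_list (map comp_edges cs)"
    using assms(1) unfolding paths_and_cycles_def by blast
  have sub: "comp_edges c \<subseteq># G" if "c \<in> set cs" for c
  proof -
    obtain xs ys where "cs = xs @ c # ys" using \<open>c \<in> set cs\<close> by (meson split_list)
    then show ?thesis by (simp add: G)
  qed
  have path: "\<not> fst c \<and> distinct (snd c) \<and> snd c \<noteq> []" if "c \<in> set cs" for c
    using ok[OF that] sub[OF that] assms(2)
    by (auto simp: comp_ok_def comp_edges_def is_path_def contains_cycle_def split: if_splits)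
  define ps where "ps = map snd cs"
  have Gps: "G = sum_list (map path_edges ps)"
    unfolding G ps_def map_map
    by (intro arg_cong[where f = sum_list] map_cong) (use path in \<open>auto simp: comp_edges_def\<close>)
  define qs where "qs = filter (\<lambda>p. length p \<ge> 2) ps"
  have Gqs: "G = sum_list (map path_edges qs)"
  proof -
    have "path_edges p = {#}" if "\<not> length p \<ge> 2" for p
    proof -
      have "size (path_edges p) = 0" using that by simp
      then show ?thesis by (simp only: size_eq_0_iff_empty)
    qed
    then have "sum_list (map path_edges xs) = sum_list (map path_edges (filter (\<lambda>p. length p \<ge> 2) xs))" for xs
      by (induction xs) auto
    then show ?thesis by (simp add: Gps qs_def)
  qed
  have dist: "distinct (concat xs)"
    if "\<And>p. p \<in> set xs \<Longrightarrow> distinct p" "\<And>i j. i < j \<Longrightarrow> j < length xs \<Longrightarrow> set (xs ! i) \<inter> set (xs ! j) = {}" for xs :: "nat list list"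
    using that
  proof (induction xs)
    case (Cons p xs)
    have "distinct (concat xs)"
    proof (rule Cons.IH)
      show "set (xs ! i) \<inter> set (xs ! j) = {}" if "i < j" "j < length xs" for i j
        using Cons.prems(2)[of "Suc i" "Suc j"] that by simp
    qed (use Cons.prems in auto)
    moreover have "set p \<inter> set q = {}" if "q \<in> set xs" for q
    proof -
      obtain j where "j < length xs" "xs ! j = q" using \<open>q \<in> set xs\<close> by (auto simp: in_set_conv_nth)
      then show ?thesis using Cons.prems(2)[of 0 "Suc j"] by simp
    qed
    ultimately show ?case using Cons.prems(1) by auto
  qed simp
  have "distinct (concat ps)"
    by (rule dist) (use path disj in \<open>auto simp: ps_def\<close>)
  then have dqs: "distinct (concat qs)"
    unfolding qs_def by (induction ps) auto
  \<comment> \<open>On a path with at least two vertices every vertex lies on an edge. This is what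
    confines the remaining paths to \<open>V\<close>.\<close>
  have sub_edge: "\<exists>e. x \<in> e \<and> e \<in># path_edges p" if "length p \<ge> 2" "x \<in> set p" for x and p :: "nat list"
    using that
  proof (induction p rule: induct_list012)
    case (3 a b r)
    show ?case
    proof (cases "x = a \<or> x = b")
      case False
      then have "x \<in> set r" using 3 by simp
      then have "\<exists>e. x \<in> e \<and> e \<in># path_edges (b # r)"
        by (intro 3(2)) (cases r; simp)+
      then show ?thesis by auto
    qed auto
  qed auto
  have inV: "set (concat qs) \<subseteq> V"
  proof
    fix x assume "x \<in> set (concat qs)"
    then obtain p where p: "p \<in> set qs" "x \<in> set p" by auto
    then have "length p \<ge> 2" by (simp add: qs_def)
    then obtain e where e: "x \<in> e" "e \<in># path_edges p" using sub_edge p by blast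
    obtain xs ys where "qs = xs @ p # ys" using p(1) by (meson split_list)
    then have "e \<in># G" using e by (simp add: Gqs)
    then show "x \<in> V" using assms(3) e by (auto simp: is_edge_def)
  qed
  define U where "U = V - set (concat qs)"
  define Q where "Q = mset qs + image_mset (\<lambda>x. [x]) (mset_set U)"
  have "(\<Sum>p\<in>#mset qs. mset p) = mset (concat qs)"
    by (induction qs) auto
  also have "\<dots> = mset_set (set (concat qs))" using dqs by (simp only: mset_set_set)
  finally have "(\<Sum>p\<in>#Q. mset p) = mset_set (set (concat qs)) + mset_set U"
    by (simp add: Q_def multiset.map_comp comp_def)
  also have "\<dots> = mset_set V"
    using inV assms(4) unfolding U_def
    by (subst mset_set_Union[symmetric]) (auto intro: arg_cong[where f = mset_set] finite_subset)
  finally have "(\<Sum>p\<in>#Q. mset p) = mset_set V" .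
  moreover have "(\<Sum>p\<in>#Q. path_edges p) = G"
    by (simp add: Q_def multiset.map_comp comp_def Gqs sum_mset_sum_list[symmetric])
  moreover have "\<forall>p\<in>#Q. p \<noteq> []" by (auto simp: Q_def qs_def)
  ultimately show ?thesis unfolding linear_forest_def by blast
qed

lemma finite_edges [simp]: "finite V \<Longrightarrow> finite (edges V)"
  by (rule finite_subset[of _ "Pow V"]) (auto simp: is_edge_def)

lemma card_edges: "finite V \<Longrightarrow> card (edges V) = card V choose 2"
  unfolding is_edge_def by (rule n_subsets)

lemma real_choose_2: "real (n choose 2) = real n * (real n - 1) / 2"
  by (simp add: choose_two real_of_nat_div) (cases n; simp add: real_of_nat_div field_simps)

lemma card_edges_at:
  assumes "finite V" "x \<in> V"
  shows "card {e \<in> edges V. x \<in> e} = card V - 1"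
proof -
  have "{e \<in> edges V. x \<in> e} = (\<lambda>y. {x, y}) ` (V - {x})"
    using assms by (auto simp: is_edge_def card_2_iff)
  moreover have "inj_on (\<lambda>y. {x, y}) (V - {x})" by (auto simp: inj_on_def doubleton_eq_iff)
  ultimately show ?thesis using assms by (simp add: card_image)
qed

text \<open>Double counting of incidences between classes and edges. The predicate selects the edges
  at a vertex, those inside a vertex set, or those different from a given edge.\<close>

lemma sum_size_filter:
  fixes k :: nat
  assumes "finite V" "\<And>i e. i < k \<Longrightarrow> e \<in># G i \<Longrightarrow> is_edge V e"
  shows "(\<Sum>i<k. size (filter_mset P (G i))) = (\<Sum>e\<in>{e\<in>edges V. P e}. \<Sum>i<k. count (G i) e)"
proof -
  have "size (filter_mset P (G i)) = (\<Sum>e\<in>{e\<in>edges V. P e}. count (G i) e)" if "i < k" for i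
  proof -
    have "size (filter_mset P (G i)) = (\<Sum>e\<in>set_mset (filter_mset P (G i)). count (filter_mset P (G i)) e)"
      by (rule size_multiset_overloaded_eq)
    also have "\<dots> = (\<Sum>e\<in>{e\<in>edges V. P e}. count (G i) e)"
      using assms that by (intro sum.mono_neutral_cong_left) (auto simp: count_eq_zero_iff)
    finally show ?thesis .
  qed
  then show ?thesis by (simp add: sum.swap[of _ "{..<k}"])
qed

lemma decomposition_sum_filter:
  assumes "decomposition l V k G" "finite V"
  shows "(\<Sum>i<k. size (filter_mset P (G i))) = l * card {e\<in>edges V. P e}"
  using assms by (subst sum_size_filter[of V]) (auto simp: decomposition_def)

lemma decomposition_sum_size:
  assumes "decomposition l V k G" "finite V"
  shows "(\<Sum>i<k. size (G i)) = l * (card V choose 2)"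
  using decomposition_sum_filter[OF assms, of "\<lambda>_. True"] assms(2) by (simp add: card_edges)

lemma decomposition_sum_deg:
  assumes "decomposition l V k G" "finite V" "x \<in> V"
  shows "(\<Sum>i<k. deg (G i) x) = l * (card V - 1)"
  using decomposition_sum_filter[OF assms(1,2), of "\<lambda>e. x \<in> e"] card_edges_at[OF assms(2,3)]
  by (simp add: deg_def)

section \<open>Adding vertices\<close>

lemma linear_forest_insert_isolated:
  assumes "linear_forest V G" "finite V" "w \<notin> V"
  shows "linear_forest (insert w V) G"
proof -
  obtain Q where Q: "\<forall>p\<in>#Q. p \<noteq> []" "(\<Sum>p\<in>#Q. mset p) = mset_set V" "G = (\<Sum>p\<in>#Q. path_edges p)"
    using assms(1) by (auto simp: linear_forest_def)
  then show ?thesis unfolding linear_forest_def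
    using assms(2,3) by (intro exI[of _ "add_mset [w] Q"]) auto
qed

lemma linear_forest_insert_leaf:
  assumes Q: "\<forall>p\<in>#Q. p \<noteq> []" "(\<Sum>p\<in>#Q. mset p) = mset_set V"
    and "p \<in># Q" "x \<in># path_ends p" "finite V" "w \<notin> V"
  shows "linear_forest (insert w V) (add_mset {x, w} (\<Sum>p\<in>#Q. path_edges p))"
proof -
  obtain Q' where Q': "Q = add_mset p Q'" using assms(3) by (metis mset_add)
  have "linear_forest (insert w V) (add_mset {x, w} (path_edges p + path_edges [w] + (\<Sum>p\<in>#Q'. path_edges p)))"
    by (rule linear_forest_join) (use assms Q' in \<open>auto simp: path_ends_def\<close>)
  then show ?thesis by (simp add: Q')
qed

text \<open>Two separate members of \<open>Q\<close> are demanded because joining \<open>w\<close>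
  to both ends of one path would close a cycle.\<close>

lemma linear_forest_insert_inner:
  assumes Q: "\<forall>p\<in>#Q. p \<noteq> []" "(\<Sum>p\<in>#Q. mset p) = mset_set V" "Q = add_mset p (add_mset q Q')"
    and xy: "x \<in># path_ends p" "y \<in># path_ends q" and w: "finite V" "w \<notin> V"
  shows "linear_forest (insert w V) (add_mset {x, w} (add_mset {y, w} (\<Sum>p\<in>#Q. path_edges p)))"
proof -
  define p' where "p' = (if last p = x then p else rev p)"
  have pq: "p \<noteq> []" "q \<noteq> []" using Q by auto
  have p': "last p' = x" "mset p' = mset p" "path_edges p' = path_edges p" "p' \<noteq> []"
    using xy pq by (auto simp: p'_def path_ends_def path_edges_rev last_rev)
  have "linear_forest (insert w V) (add_mset {w, y} (path_edges (p' @ [w]) + path_edges q + (\<Sum>p\<in>#Q'. path_edges p)))"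
    by (rule linear_forest_join) (use Q p' xy pq w in \<open>auto simp: path_ends_def add.assoc\<close>)
  then show ?thesis
    using p' by (simp add: Q(3) path_edges_append insert_commute add.assoc add_mset_commute)
qed

lemma count_image_mset_set:
  "finite S \<Longrightarrow> count (image_mset r (mset_set S)) x = card {e\<in>S. r e = x}"
proof (induction S rule: finite_induct)
  case (insert a S)
  have "{e\<in>insert a S. r e = x} = (if r a = x then insert a {e\<in>S. r e = x} else {e\<in>S. r e = x})"
    by auto
  then show ?case using insert by auto
qed simp

lemma mset_conv_nth: "mset xs = image_mset ((!) xs) (mset_set {..<length xs})"
  by (metis atLeast0LessThan map_nth mset_map mset_upt)

lemma mset_add_nth: "i < length xs \<Longrightarrow> \<exists>Q. mset xs = add_mset (xs ! i) Q"
  by (metis insert_DiffM nth_mem_mset)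

lemma mset_add_nth2:
  assumes "i < length xs" "j < length xs" "i \<noteq> j"
  shows "\<exists>Q. mset xs = add_mset (xs ! i) (add_mset (xs ! j) Q)"
proof -
  have "mset_set {..<length xs} = add_mset i (mset_set ({..<length xs} - {i}))"
    using assms by (intro mset_set.remove) auto
  also have "mset_set ({..<length xs} - {i}) = add_mset j (mset_set ({..<length xs} - {i} - {j}))"
    using assms by (intro mset_set.remove) auto
  finally show ?thesis unfolding mset_conv_nth[of xs] by auto
qed

text \<open>\<open>X i\<close> lists the old vertices that class \<open>i\<close> joins to the new
  vertex \<open>n\<close>. It is a multiset because a one-vertex path is closed to a cycle of length
  2, which uses its vertex twice.\<close>

lemma decomposition_add_vertex:
  fixes n mu k :: nat
  assumes B: "decomposition mu {0..<n} k B"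
    and X: "\<And>i x. i < k \<Longrightarrow> x \<in># X i \<Longrightarrow> x < n"
    and cnt: "\<And>x. x < n \<Longrightarrow> (\<Sum>i<k. count (X i) x) = mu"
  shows "decomposition mu {0..<Suc n} k (\<lambda>i. B i + image_mset (\<lambda>x. {x, n}) (X i))"
proof -
  have edge: "is_edge {0..<Suc n} e" if "i < k" "e \<in># B i + image_mset (\<lambda>x. {x, n}) (X i)" for i e
    using that B X[OF that(1)] by (force simp: decomposition_def is_edge_def)
  have "(\<Sum>i<k. count (B i + image_mset (\<lambda>x. {x, n}) (X i)) e) = mu" if e: "is_edge {0..<Suc n} e" for e
  proof (cases "n \<in> e")
    case True
    then obtain x where x: "e = {x, n}" "x \<noteq> n" using e
      by (auto simp: is_edge_def card_2_iff)
    then have "x < n" using e by (auto simp: is_edge_def)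
    have "count (B i) e = 0" if "i < k" for i
      using B that True by (fastforce simp: decomposition_def is_edge_def count_eq_zero_iff)
    moreover have "count (image_mset (\<lambda>x. {x, n}) (X i)) e = count (X i) x" if "i < k" for i
    proof -
      have "count (image_mset (\<lambda>x. {x, n}) M) {x, n} = count M x" if "\<And>y. y \<in># M \<Longrightarrow> y < n" for M
        using that \<open>x < n\<close> by (induction M) (auto simp: doubleton_eq_iff)
      then show ?thesis using X[OF \<open>i < k\<close>] x(1) by blast
    qed
    ultimately show ?thesis using cnt[OF \<open>x < n\<close>] by simp
  next
    case False
    then have "is_edge {0..<n} e" using e by (auto simp: is_edge_def less_Suc_eq)
    moreover have "count (image_mset (\<lambda>x. {x, n}) (X i)) e = 0" for i
      using False by (auto simp: count_eq_zero_iff)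
    ultimately show ?thesis using B by (simp add: decomposition_def)
  qed
  then show ?thesis using edge by (auto simp: decomposition_def)
qed

lemma sum_mset_nth: "(\<Sum>x\<in>#mset xs. f x) = (\<Sum>i<length xs. f (xs ! i))"
proof -
  have "(\<Sum>x\<in>#mset xs. f x) = sum_list (map f xs)"
    by (metis mset_map sum_mset_sum_list)
  then show ?thesis by (simp add: sum_list_sum_nth atLeast0LessThan)
qed

text \<open>Lists instead of multisets of paths, so that a path is addressed by its class and its
  position.\<close>

lemma linear_forest_decomposition_lists:
  assumes "\<And>i. i < k \<Longrightarrow> linear_forest V (B i)"
  shows "\<exists>cs. \<forall>i<k. (\<forall>p\<in>#mset (cs i). p \<noteq> []) \<and>
    (\<Sum>p\<in>#mset (cs i). mset p) = mset_set V \<and> B i = (\<Sum>p\<in>#mset (cs i). path_edges p)"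
proof -
  have "\<forall>i\<in>{..<k}. \<exists>c. (\<forall>p\<in>#mset c. p \<noteq> []) \<and>
    (\<Sum>p\<in>#mset c. mset p) = mset_set V \<and> B i = (\<Sum>p\<in>#mset c. path_edges p)"
    using assms unfolding linear_forest_def by (metis ex_mset lessThan_iff)
  from bchoice[OF this] show ?thesis by (simp only: lessThan_iff Ball_def)
qed

text \<open>The size bound says that no class has more than \<open>m\<close> paths, and the value of
  \<open>k\<close> gives every vertex \<open>mu * m\<close> path ends in all. Both must survive each
  step with \<open>n\<close> increased and \<open>m\<close> decreased by one.\<close>

theorem hamiltonian_embedding:
  fixes n m k mu :: nat
  assumes "1 \<le> m" "1 \<le> n"
    and "\<And>i. i < k \<Longrightarrow> linear_forest {0..<n} (B i)"
    and "\<And>i. i < k \<Longrightarrow> n \<le> size (B i) + m"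
    and "decomposition mu {0..<n} k B"
    and "2 * k = mu * (n + m - 1)"
  shows "\<exists>H. hamiltonian_decomposition mu {0..<n+m} k H \<and> (\<forall>i<k. B i \<subseteq># H i)"
  using assms
proof (induction m arbitrary: n B rule: nat_induct_at_least)
  case base
  note B = base(2-5) and n = base(1)
  obtain cs where cs: "\<And>i. i < k \<Longrightarrow> (\<forall>p\<in>#mset (cs i). p \<noteq> []) \<and>
    (\<Sum>p\<in>#mset (cs i). mset p) = mset_set {0..<n} \<and> B i = (\<Sum>p\<in>#mset (cs i). path_edges p)"
    using linear_forest_decomposition_lists[of k "{0..<n}" B] B(1) by meson
  define p where "p i = hd (cs i)" for i
  have "\<exists>q. cs i = [q]" if i: "i < k" for i
  proof -
    have "size (B i) + length (cs i) = n"
      using linear_forest_size[of "mset (cs i)" "{0..<n}"] cs[OF i] by simp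
    then have "length (cs i) \<le> 1" using B(2)[OF i] by linarith
    moreover have "cs i \<noteq> []"
    proof
      assume "cs i = []"
      then have "mset_set {0..<n} = {#}" using cs[OF i] by simp
      then show False using n by (simp add: mset_set_empty_iff)
    qed
    ultimately show ?thesis by (cases "cs i") auto
  qed
  then have p: "cs i = [p i]" if "i < k" for i using that by (fastforce simp: p_def)
  have Bp: "B i = path_edges (p i)" "mset (p i) = mset_set {0..<n}" "p i \<noteq> []" if "i < k" for i
    using cs[OF that] p[OF that] by auto
  have setp: "set (p i) = {0..<n}" "distinct (p i)" if "i < k" for i
  proof -
    show "set (p i) = {0..<n}" using arg_cong[OF Bp(2)[OF that], of set_mset] by simp
    show "distinct (p i)" using mset_cover_distinct[of "{#p i#}" "{0..<n}"] Bp(2)[OF that] by simp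
  qed
  \<comment> \<open>For \<open>m = 1\<close> there are \<open>2 * k = mu * n\<close> units of degree
    plus ends at \<open>x\<close>, and \<open>mu * (n - 1)\<close> of them are degree.\<close>
  have cnt: "(\<Sum>i<k. count (path_ends (p i)) x) = mu" if x: "x < n" for x
  proof -
    have "count (path_ends (p i)) x + deg (B i) x = 2" if "i < k" for i
      using path_ends_deg[OF setp(2)[OF that] Bp(3)[OF that], of x] Bp[OF that] x by simp
    then have "(\<Sum>i<k. count (path_ends (p i)) x + deg (B i) x) = 2 * k" by simp
    then have "(\<Sum>i<k. count (path_ends (p i)) x) + mu * (n - 1) = mu * (n - 1) + mu"
      using decomposition_sum_deg[OF B(3), of x] x B(4) n
      by (cases n) (auto simp: sum.distrib)
    then show ?thesis by simp
  qed
  define H where "H i = B i + image_mset (\<lambda>x. {x, n}) (path_ends (p i))" for i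
  have dec: "decomposition mu {0..<Suc n} k H"
    unfolding H_def
  proof (rule decomposition_add_vertex[OF B(3)])
    show "x < n" if "i < k" "x \<in># path_ends (p i)" for i x
      using path_ends_subset[OF Bp(3)] setp(1) that by fastforce
  qed (rule cnt)
  have "hamiltonian_cycle {0..<Suc n} (H i)" if i: "i < k" for i
    unfolding hamiltonian_cycle_def
  proof (intro exI[of _ "p i @ [n]"] conjI)
    show "is_cycle (p i @ [n])" using Bp(3)[OF i] setp[OF i] by (cases "p i") (auto simp: is_cycle_def)
    show "set (p i @ [n]) = {0..<Suc n}" using setp[OF i] by auto
    show "H i = cycle_edges (p i @ [n])"
      using Bp[OF i] by (simp add: H_def cycle_edges_eq path_edges_append path_ends_def insert_commute add_mset_commute)
  qed
  moreover have "B i \<subseteq># H i" for i by (simp add: H_def)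
  ultimately show ?case using dec by (intro exI[of _ H]) (simp add: hamiltonian_decomposition_def)
next
  case (Suc m)
  note m = Suc.hyps and B = Suc.prems(2-5) and n = Suc.prems(1)
  obtain cs where cs: "\<And>i. i < k \<Longrightarrow> (\<forall>p\<in>#mset (cs i). p \<noteq> []) \<and>
    (\<Sum>p\<in>#mset (cs i). mset p) = mset_set {0..<n} \<and> B i = (\<Sum>p\<in>#mset (cs i). path_edges p)"
    using linear_forest_decomposition_lists[of k "{0..<n}" B] B(1) by meson
  have len: "size (B i) + length (cs i) = n" if "i < k" for i
    using linear_forest_size[of "mset (cs i)" "{0..<n}"] cs[OF that] by simp
  \<comment> \<open>The triple of class, position and side stands for one end of one path. A trivial
    path supplies two elements with the same vertex.\<close>
  define E where "E = (SIGMA i:{..<k}. {..<length (cs i)} \<times> (UNIV::bool set))"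
  define r where "r = (\<lambda>(i, j, b). if b then hd (cs i ! j) else last (cs i ! j))"
  define p :: "nat \<times> nat \<times> bool \<Rightarrow> nat \<times> nat" where "p = (\<lambda>(i, j, b). (i, j))"
  have finE: "finite E" by (simp add: E_def)
  have r_end: "r (i, j, b) \<in># path_ends (cs i ! j)" for i j b by (simp add: r_def path_ends_def)
  have r_less: "r e < n" if "e \<in> E" for e
  proof -
    obtain i j b where e: "e = (i, j, b)" "i < k" "j < length (cs i)" using \<open>e \<in> E\<close> by (auto simp: E_def)
    obtain Q where Q: "mset (cs i) = add_mset (cs i ! j) Q" using mset_add_nth[OF e(3)] by blast
    have "cs i ! j \<noteq> []" using cs[OF e(2)] e(3) by auto
    then have "r e \<in> set (cs i ! j)" using path_ends_subset[OF _ r_end] e(1) by blast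
    then have "r e \<in># (\<Sum>p\<in>#mset (cs i). mset p)" unfolding Q by simp
    then show ?thesis using cs[OF e(2)] by simp
  qed
  have card_r: "card {e\<in>E. r e = x} = mu * Suc m" if x: "x < n" for x
  proof -
    have "{e\<in>E. r e = x} = (SIGMA i:{..<k}. SIGMA j:{..<length (cs i)}. {b. r (i, j, b) = x})"
      by (auto simp: E_def)
    moreover have "card {b. r (i, j, b) = x} = count (path_ends (cs i ! j)) x" for i j
    proof -
      have "{b. r (i, j, b) = x} = (if hd (cs i ! j) = x then {True} else {}) \<union> (if last (cs i ! j) = x then {False} else {})"
        by (auto simp: r_def split: if_splits)
      then show ?thesis by (simp add: path_ends_def)
    qed
    ultimately have "card {e\<in>E. r e = x} = (\<Sum>i<k. \<Sum>p\<in>#mset (cs i). count (path_ends p) x)"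
      by (simp add: sum_mset_nth)
    moreover have "(\<Sum>p\<in>#mset (cs i). count (path_ends p) x) + deg (B i) x = 2" if "i < k" for i
      using linear_forest_ends[of "mset (cs i)" "{0..<n}" x] cs[OF that] x by simp
    then have "(\<Sum>i<k. (\<Sum>p\<in>#mset (cs i). count (path_ends p) x) + deg (B i) x) = 2 * k" by simp
    moreover have "(\<Sum>i<k. deg (B i) x) = mu * (n - 1)"
      using decomposition_sum_deg[OF B(3), of x] x by simp
    ultimately have "card {e\<in>E. r e = x} + mu * (n - 1) = mu * (n + Suc m - 1)"
      using B(4) by (simp only: sum.distrib)
    also have "\<dots> = mu * (n - 1) + mu * Suc m"
      using n by (cases n) (simp_all add: algebra_simps)
    finally show ?thesis by simp
  qed
  define f :: "nat \<times> nat \<times> bool \<Rightarrow> real" where "f e = 1 / real (Suc m)" for e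
  have sumf: "sum f S = card S / real (Suc m)" for S by (simp add: f_def)
  obtain g :: "nat \<times> nat \<times> bool \<Rightarrow> int" where
    g1: "\<And>e. e \<in> E \<Longrightarrow> \<lfloor>f e\<rfloor> \<le> g e \<and> g e \<le> \<lceil>f e\<rceil>" and
    g2: "\<And>y. \<lfloor>sum f {e\<in>E. p e = y}\<rfloor> \<le> sum g {e\<in>E. p e = y} \<and> sum g {e\<in>E. p e = y} \<le> \<lceil>sum f {e\<in>E. p e = y}\<rceil>" and
    g3: "\<And>z. \<lfloor>sum f {e\<in>E. fst (p e) = z}\<rfloor> \<le> sum g {e\<in>E. fst (p e) = z} \<and> sum g {e\<in>E. fst (p e) = z} \<le> \<lceil>sum f {e\<in>E. fst (p e) = z}\<rceil>" and
    g4: "\<And>x. \<lfloor>sum f {e\<in>E. r e = x}\<rfloor> \<le> sum g {e\<in>E. r e = x} \<and> sum g {e\<in>E. r e = x} \<le> \<lceil>sum f {e\<in>E. r e = x}\<rceil>"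
    by (rule fibre_rounding[OF finE, where f = f and p = p and c = fst and r = r], rule that)
  define C where "C = {e\<in>E. g e = 1}"
  have g01: "g e = of_bool (e \<in> C)" if "e \<in> E" for e
  proof -
    have "\<lfloor>f e\<rfloor> = 0" "\<lceil>f e\<rceil> \<le> 1" using m by (simp_all add: f_def ceiling_le_iff floor_eq_iff)
    then have "g e = 0 \<or> g e = 1" using g1[OF that] by linarith
    then show ?thesis using that by (auto simp: C_def)
  qed
  have sumg: "sum g {e\<in>E. P e} = int (card {e\<in>C. P e})" for P
  proof -
    have "sum g {e\<in>E. P e} = (\<Sum>e\<in>{e\<in>E. P e}. of_bool (e \<in> C))"
      by (intro sum.cong) (auto simp: g01)
    also have "\<dots> = (\<Sum>e\<in>{e\<in>C. P e}. 1)"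
      using finE by (intro sum.mono_neutral_cong_right) (auto simp: C_def)
    finally show ?thesis by simp
  qed
  have CE: "C \<subseteq> E" "finite C" using finE by (auto simp: C_def)
  \<comment> \<open>A path has fractional weight \<open>2 / Suc m\<close>, which is at most 1
    because at least two vertices are missing. Rounding therefore never selects both ends of a path,
    which would close a cycle too early.\<close>
  have pair: "b = b'" if "(i, j, b) \<in> C" "(i, j, b') \<in> C" for i j b b'
  proof (rule ccontr)
    assume "b \<noteq> b'"
    have "{e\<in>E. p e = (i, j)} = {(i, j, True), (i, j, False)}"
      using that CE by (auto simp: E_def p_def)
    then have "sum f {e\<in>E. p e = (i, j)} \<le> 1" using m by (simp add: sumf)
    then have "card {e\<in>C. p e = (i, j)} \<le> 1" using g2[of "(i, j)"] by (simp add: sumg ceiling_le_iff) linarith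
    moreover have "{(i, j, b), (i, j, b')} \<subseteq> {e\<in>C. p e = (i, j)}" using that by (auto simp: p_def)
    then have "card {(i, j, b), (i, j, b')} \<le> card {e\<in>C. p e = (i, j)}" using CE by (intro card_mono) auto
    ultimately show False using \<open>b \<noteq> b'\<close> by simp
  qed
  define S where "S i = {e\<in>C. fst e = i}" for i
  have finS: "finite (S i)" for i using CE by (simp add: S_def)
  have card_S: "card (S i) \<le> 2" "length (cs i) + 2 \<le> card (S i) + Suc m" if i: "i < k" for i
  proof -
    have "{e\<in>E. fst (p e) = i} = {i} \<times> {..<length (cs i)} \<times> UNIV"
      using i by (auto simp: E_def p_def)
    then have sf: "sum f {e\<in>E. fst (p e) = i} = 2 * real (length (cs i)) / Suc m"
      unfolding sumf by (simp add: card_cartesian_product)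
    have sg: "sum g {e\<in>E. fst (p e) = i} = int (card (S i))"
      unfolding sumg S_def by (simp add: p_def case_prod_unfold)
    have l: "length (cs i) \<le> Suc m" using len[OF i] B(2)[OF i] by linarith
    then have "2 * real (length (cs i)) / Suc m \<le> 2" by (simp add: divide_le_eq)
    then show "card (S i) \<le> 2" using g3[of i] unfolding sf sg by linarith
    \<comment> \<open>With \<open>c\<close> paths in the class, this product rearranges to
      \<open>c + 2 - Suc m \<le> 2 * c / Suc m\<close>. The left-hand side is an integer and so
      survives rounding down; it guarantees that the extended class has at most \<open>m\<close>
      paths.\<close>
    have "(real m - 1) * (real m + 1 - length (cs i)) \<ge> 0" using m l by (intro mult_nonneg_nonneg) auto
    then have "real (length (cs i)) + 2 - Suc m \<le> 2 * real (length (cs i)) / Suc m"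
      by (simp add: le_divide_eq algebra_simps)
    then show "length (cs i) + 2 \<le> card (S i) + Suc m" using g3[of i] unfolding sf sg by linarith
  qed
  define X where "X i = image_mset r (mset_set (S i))" for i
  define B' where "B' i = B i + image_mset (\<lambda>x. {x, n}) (X i)" for i
  have dec: "decomposition mu {0..<Suc n} k B'"
    unfolding B'_def
  proof (rule decomposition_add_vertex[OF B(3)])
    show "x < n" if "i < k" "x \<in># X i" for i x
      using that r_less CE finS by (auto simp: X_def S_def)
    show "(\<Sum>i<k. count (X i) x) = mu" if x: "x < n" for x
    proof -
      have "(\<Sum>i<k. count (X i) x) = (\<Sum>i<k. card {e\<in>{e\<in>C. r e = x}. fst e = i})"
        unfolding X_def count_image_mset_set[OF finS]
        by (intro sum.cong refl arg_cong[where f = card]) (auto simp: S_def)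
      also have "\<dots> = card {e\<in>C. r e = x}"
        by (rule sum_card_fibres) (use CE in \<open>auto simp: E_def\<close>)
      \<comment> \<open>The fractional sum at \<open>x\<close> is \<open>mu * Suc m / Suc m\<close>,
        an integer, so that floor and ceiling leave no choice.\<close>
      also have "sum f {e\<in>E. r e = x} = of_int (int mu)"
        by (simp add: sumf card_r[OF x] del: of_nat_Suc mult_Suc_right)
      then have "card {e\<in>C. r e = x} = mu" using g4[of x] unfolding sumg by simp
      finally show ?thesis .
    qed
  qed
  have forest: "linear_forest {0..<Suc n} (B' i)" if i: "i < k" for i
  proof -
    have ins: "{0..<Suc n} = insert n {0..<n}" by auto
    have Q: "\<forall>p\<in>#mset (cs i). p \<noteq> []" "(\<Sum>p\<in>#mset (cs i). mset p) = mset_set {0..<n}" "B i = (\<Sum>p\<in>#mset (cs i). path_edges p)"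
      using cs[OF i] by auto
    have mem: "\<exists>j b. e = (i, j, b) \<and> j < length (cs i)" if "e \<in> S i" for e
      using that CE by (auto simp: S_def E_def)
    consider "card (S i) = 0" | "card (S i) = 1" | "card (S i) = 2" using card_S(1)[OF i] by linarith
    then show ?thesis
    proof cases
      case 1
      then have "B' i = B i" using finS by (simp add: B'_def X_def)
      then show ?thesis using linear_forest_insert_isolated[OF B(1)[OF i]] by (simp add: ins)
    next
      case 2
      then obtain e where "S i = {e}" by (auto simp: card_1_singleton_iff)
      then obtain j b where S: "S i = {(i, j, b)}" "j < length (cs i)" using mem by auto
      then have "B' i = add_mset {r (i, j, b), n} (B i)" by (simp add: B'_def X_def)
      then show ?thesis
        using linear_forest_insert_leaf[OF Q(1,2) _ r_end[of i j b], of n] S(2) by (simp add: ins Q(3))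
    next
      case 3
      then obtain e e' where Se: "S i = {e, e'}" "e \<noteq> e'" by (auto simp: card_2_iff)
      then obtain j b j' b' where S: "e = (i, j, b)" "j < length (cs i)" "e' = (i, j', b')" "j' < length (cs i)"
        using mem by (metis insertCI)
      have "j \<noteq> j'" using pair[of i j b b'] Se S by (auto simp: S_def)
      then obtain Q' where "mset (cs i) = add_mset (cs i ! j) (add_mset (cs i ! j') Q')"
        using mset_add_nth2 S by metis
      from linear_forest_insert_inner[OF Q(1,2) this r_end[of i j b] r_end[of i j' b'], of n]
      have "linear_forest {0..<Suc n} (add_mset {r e, n} (add_mset {r e', n} (B i)))"
        by (simp add: ins Q(3) S)
      moreover have "B' i = add_mset {r e, n} (add_mset {r e', n} (B i))"
        using Se by (simp add: B'_def X_def)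
      ultimately show ?thesis by simp
    qed
  qed
  have sz: "Suc n \<le> size (B' i) + m" if "i < k" for i
    using len[OF that] card_S(2)[OF that] by (simp add: B'_def X_def)
  have "2 * k = mu * (Suc n + m - 1)" using B(4) by simp
  from Suc.IH[OF _ forest sz dec this]
  obtain H where H: "hamiltonian_decomposition mu {0..<Suc n + m} k H" "\<forall>i<k. B' i \<subseteq># H i"
    by auto
  have "B i \<subseteq># H i" if "i < k" for i
    using H(2) that subset_mset.order_trans[of "B i" "B' i" "H i"] by (auto simp: B'_def)
  then show ?case using H(1) by (intro exI[of _ H]) auto
qed

section \<open>Adding edges\<close>

definition partial_enclosure ::
  "nat \<Rightarrow> nat set \<Rightarrow> nat \<Rightarrow> (nat \<Rightarrow> nat set multiset) \<Rightarrow> (nat \<Rightarrow> nat set multiset) \<Rightarrow> bool" where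
  "partial_enclosure mu V k A B \<longleftrightarrow> (\<forall>i<k. A i \<subseteq># B i \<and> linear_forest V (B i)) \<and>
     (\<forall>e. is_edge V e \<longrightarrow> (\<Sum>i<k. count (B i) e) \<le> mu)"

lemma partial_enclosure_is_edge:
  "partial_enclosure mu V k A B \<Longrightarrow> finite V \<Longrightarrow> i < k \<Longrightarrow> e \<in># B i \<Longrightarrow> is_edge V e"
  by (meson linear_forest_is_edge partial_enclosure_def)

text \<open>Every edge in \<open>U\<close> still lacks a copy and so improves the upper bound by
  one. One or two known missing edges are enough to make degree counts tight later.\<close>

lemma partial_enclosure_sum_filter:
  assumes "partial_enclosure mu V k A B" "finite V"
    and "U \<subseteq> {e\<in>edges V. P e}" "\<And>e. e \<in> U \<Longrightarrow> (\<Sum>i<k. count (B i) e) < mu"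
  shows "(\<Sum>i<k. size (filter_mset P (B i))) + card U \<le> mu * card {e\<in>edges V. P e}"
proof -
  have fin: "finite {e\<in>edges V. P e}" using assms(2) by simp
  have "(\<Sum>e\<in>{e\<in>edges V. P e}. of_bool (e \<in> U)) = (\<Sum>e\<in>U. 1::nat)"
    using fin assms(3) by (intro sum.mono_neutral_cong_right) auto
  then have "(\<Sum>i<k. size (filter_mset P (B i))) + card U =
      (\<Sum>e\<in>{e\<in>edges V. P e}. \<Sum>i<k. count (B i) e) + (\<Sum>e\<in>{e\<in>edges V. P e}. of_bool (e \<in> U))"
    using sum_size_filter[of V k B P] partial_enclosure_is_edge[OF assms(1,2)] assms(2) by simp
  also have "\<dots> \<le> (\<Sum>e\<in>{e\<in>edges V. P e}. mu)"
    unfolding sum.distrib[symmetric]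
  proof (rule sum_mono)
    fix e assume "e \<in> {e\<in>edges V. P e}"
    then show "(\<Sum>i<k. count (B i) e) + of_bool (e \<in> U) \<le> mu"
      using assms(1) assms(4)[of e] by (cases "e \<in> U") (auto simp: partial_enclosure_def Suc_le_eq)
  qed
  finally show ?thesis by (simp add: mult.commute)
qed

lemma partial_enclosure_sum_deg:
  assumes "partial_enclosure mu V k A B" "finite V" "x \<in> V"
    and "U \<subseteq> {e\<in>edges V. x \<in> e}" "\<And>e. e \<in> U \<Longrightarrow> (\<Sum>i<k. count (B i) e) < mu"
  shows "(\<Sum>i<k. deg (B i) x) + card U \<le> mu * (card V - 1)"
  using partial_enclosure_sum_filter[OF assms(1,2,4,5)] card_edges_at[OF assms(2,3)]
  by (simp add: deg_def)

lemma partial_enclosure_complete: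
  assumes "partial_enclosure mu V k A B" "finite V"
    and "\<And>e. is_edge V e \<Longrightarrow> \<not> (\<Sum>i<k. count (B i) e) < mu"
  shows "decomposition mu V k B"
  using assms partial_enclosure_is_edge[OF assms(1,2)]
  by (force simp: decomposition_def partial_enclosure_def intro: antisym)

lemma sum_fun_upd:
  fixes f :: "'b \<Rightarrow> nat" and j k :: nat
  assumes "j < k"
  shows "(\<Sum>i<k. f ((B(j := Y)) i)) + f (B j) = (\<Sum>i<k. f (B i)) + f Y"
proof -
  have "(\<Sum>i\<in>{..<k} - {j}. f ((B(j := Y)) i)) = (\<Sum>i\<in>{..<k} - {j}. f (B i))"
    by (intro sum.cong) auto
  then show ?thesis
    using sum.remove[of "{..<k}" j "\<lambda>i. f ((B(j := Y)) i)", OF finite_lessThan]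
      sum.remove[of "{..<k}" j "\<lambda>i. f (B i)", OF finite_lessThan] assms
    by simp
qed

text \<open>In an enclosure with as many edges as possible, a missing edge \<open>uv\<close> forces \<open>u\<close> and \<open>v\<close> to
  have total degree at least 2 in each class. If \<open>k + 1 = \<mu>(|V| - 1)\<close> it is exactly 2; exchanging an
  added copy of \<open>ux\<close> for \<open>uv\<close> in class \<open>j\<close> shows that a class \<open>j' \<noteq> j\<close> containing \<open>ux\<close> has \<open>ux\<close>
  as a component, so that \<open>uv\<close> could have been added there.\<close>

theorem complete_enclosure:
  fixes k mu lam s :: nat
  assumes V: "finite V" and A: "decomposition lam V k A" "lam < mu"
    and B0: "partial_enclosure mu V k A B0" "\<And>i. i < k \<Longrightarrow> s \<le> size (B0 i)"
    and k: "mu * (card V - 1) \<le> k \<or> 3 \<le> card V \<and> 2 \<le> mu \<and> mu * (card V - 1) \<le> k + 1"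
  shows "\<exists>B. partial_enclosure mu V k A B \<and> decomposition mu V k B \<and> (\<forall>i<k. s \<le> size (B i))"
proof -
  define P where "P B \<longleftrightarrow> partial_enclosure mu V k A B \<and> (\<forall>i<k. s \<le> size (B i))" for B
  define tot where "tot B = (\<Sum>i<k. size (B i))" for B :: "nat \<Rightarrow> nat set multiset"
  have bound: "\<forall>B. P B \<longrightarrow> tot B < Suc (mu * card (edges V))"
    using partial_enclosure_sum_filter[of mu V k A _ "{}" "\<lambda>_. True"] V by (simp add: P_def tot_def less_Suc_eq_le)
  have "P B0" using B0 by (simp add: P_def)
  from ex_has_greatest_nat[OF this bound]
  obtain Bm where Bm: "P Bm" "\<And>B. P B \<Longrightarrow> tot B \<le> tot Bm" by auto
  \<comment> \<open>A property rather than the fixed maximum \<open>Bm\<close>, since the tightness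
    argument is also applied to the enclosure obtained by the exchange.\<close>
  define opt where "opt B \<longleftrightarrow> P B \<and> tot B = tot Bm" for B
  have not_addable: "\<not> linear_forest V (add_mset e (B i))"
    if B: "opt B" and e: "is_edge V e" "(\<Sum>i<k. count (B i) e) < mu" and i: "i < k" for B e i
  proof
    assume lf: "linear_forest V (add_mset e (B i))"
    define B' where "B' = B(i := add_mset e (B i))"
    have "(\<Sum>i<k. count (B' i) f) \<le> mu" if "is_edge V f" for f
    proof -
      have "(\<Sum>i<k. count (B' i) f) = (\<Sum>i<k. count (B i) f) + of_bool (f = e)"
        using sum_fun_upd[OF i, of "\<lambda>M. count M f" B "add_mset e (B i)"]
        by (cases "f = e") (simp_all flip: B'_def)
      moreover have "(\<Sum>i<k. count (B i) f) \<le> mu"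
        using B that by (simp add: opt_def P_def partial_enclosure_def)
      ultimately show ?thesis using e(2) by (cases "f = e") auto
    qed
    then have "partial_enclosure mu V k A B'"
      using B lf by (auto simp: B'_def opt_def P_def partial_enclosure_def intro: subset_mset.order_trans)
    then have "P B'" using B by (auto simp: B'_def opt_def P_def le_Suc_eq)
    moreover have "tot B' = tot B + 1"
      using sum_fun_upd[OF i, of size B "add_mset e (B i)"] by (simp add: B'_def[symmetric] tot_def)
    ultimately show False using Bm(2)[of B'] B by (simp add: opt_def)
  qed
  have tight: "3 \<le> card V \<and> 2 \<le> mu \<and> (\<forall>i<k. deg (B i) u + deg (B i) v = 2) \<and>
      (\<forall>x\<in>V - {u, v}. (\<Sum>i<k. count (B i) {u, x}) = mu)"
    if B: "opt B" and uv: "is_edge V {u, v}" "(\<Sum>i<k. count (B i) {u, v}) < mu" for B u v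
  proof -
    have uvV: "u \<in> V" "v \<in> V" "u \<noteq> v" using uv(1) by (auto simp: is_edge_def card_2_iff doubleton_eq_iff)
    have pe: "partial_enclosure mu V k A B" using B by (simp add: opt_def P_def)
    have ge2: "2 \<le> deg (B i) u + deg (B i) v" if i: "i < k" for i
    proof (rule ccontr)
      assume "\<not> ?thesis"
      then have "linear_forest V (add_mset {u, v} (B i))"
        using pe i uvV V by (intro linear_forest_add_edge) (auto simp: partial_enclosure_def)
      then show False using not_addable[OF B uv i] by simp
    qed
    have du: "(\<Sum>i<k. deg (B i) u) + card U \<le> mu * (card V - 1)"
      if "U \<subseteq> {e\<in>edges V. u \<in> e}" "\<And>e. e \<in> U \<Longrightarrow> (\<Sum>i<k. count (B i) e) < mu" for U
      by (rule partial_enclosure_sum_deg[OF pe V uvV(1) that])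
    have dv: "(\<Sum>i<k. deg (B i) v) + 1 \<le> mu * (card V - 1)"
      using partial_enclosure_sum_deg[OF pe V uvV(2), of "{{u, v}}"] uv by simp
    have du1: "(\<Sum>i<k. deg (B i) u) + 1 \<le> mu * (card V - 1)"
      using du[of "{{u, v}}"] uv by simp
    have "(\<Sum>i<k. 2) \<le> (\<Sum>i<k. deg (B i) u + deg (B i) v)"
      using ge2 by (intro sum_mono) auto
    then have ge: "2 * k \<le> (\<Sum>i<k. deg (B i) u) + (\<Sum>i<k. deg (B i) v)"
      by (simp add: sum.distrib)
    \<comment> \<open>The missing copy of \<open>uv\<close> lowers both degree sums below
      \<open>mu * (card V - 1)\<close>, whereas together they are at least \<open>2 * k\<close>.
      This refutes the first alternative for \<open>k\<close> and turns the second into an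
      equation.\<close>
    have c: "3 \<le> card V" "2 \<le> mu" "mu * (card V - 1) = k + 1" using k ge du1 dv by linarith+
    have eq: "deg (B i) u + deg (B i) v = 2" if i: "i < k" for i
    proof (rule ccontr)
      assume "\<not> ?thesis"
      then have "2 < deg (B i) u + deg (B i) v" using ge2[OF i] by linarith
      then have "(\<Sum>i<k. 2) < (\<Sum>i<k. deg (B i) u + deg (B i) v)"
        using ge2 i by (intro sum_strict_mono_ex1) auto
      then show False using du1 dv c by (simp add: sum.distrib)
    qed
    \<comment> \<open>A second missing edge at \<open>u\<close> would lower the degree sum of
      \<open>u\<close> by one more, and no slack is left for that.\<close>
    have sat: "(\<Sum>i<k. count (B i) {u, x}) = mu" if x: "x \<in> V - {u, v}" for x
    proof (rule ccontr)
      assume ne: "\<not> ?thesis"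
      have ux: "is_edge V {u, x}" using x uvV by (auto simp: is_edge_def)
      then have "(\<Sum>i<k. count (B i) {u, x}) < mu"
        using ne pe by (auto simp: partial_enclosure_def le_neq_implies_less)
      moreover have "{u, v} \<noteq> {u, x}" using x by (auto simp: doubleton_eq_iff)
      ultimately have "(\<Sum>i<k. deg (B i) u) + 2 \<le> mu * (card V - 1)"
        using du[of "{{u, v}, {u, x}}"] uv ux by auto
      then show False using ge dv c by linarith
    qed
    show ?thesis using c eq sat by blast
  qed
  have "opt Bm" using Bm by (simp add: opt_def)
  have placed: "\<not> (\<Sum>i<k. count (Bm i) e) < mu" if e: "is_edge V e" for e
  proof
    assume miss: "(\<Sum>i<k. count (Bm i) e) < mu"
    obtain u v where uv: "e = {u, v}" "u \<noteq> v" using e by (auto simp: is_edge_def card_2_iff)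
    then have uvV: "u \<in> V" "v \<in> V" using e by (auto simp: is_edge_def)
    have pe: "partial_enclosure mu V k A Bm" using Bm by (simp add: P_def)
    have t: "3 \<le> card V" "2 \<le> mu" "\<And>i. i < k \<Longrightarrow> deg (Bm i) u + deg (Bm i) v = 2"
        "\<And>x. x \<in> V - {u, v} \<Longrightarrow> (\<Sum>i<k. count (Bm i) {u, x}) = mu"
      using tight[OF \<open>opt Bm\<close>, of u v] e miss uv by auto
    have "\<not> V \<subseteq> {u, v}"
    proof
      assume "V \<subseteq> {u, v}"
      then have "card V \<le> card {u, v}" by (intro card_mono) auto
      then show False using t(1) uv(2) by simp
    qed
    then obtain x where x: "x \<in> V - {u, v}" by blast
    have ux: "is_edge V {u, x}" using x uvV by (auto simp: is_edge_def)
    have cnt: "(\<Sum>i<k. count (Bm i) {u, x}) = mu" using t(4)[OF x] .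
    \<comment> \<open>Only \<open>lam < mu\<close> of the \<open>mu\<close> copies of
      \<open>ux\<close> come from \<open>A\<close>, so some class holds a copy that may be
      moved.\<close>
    obtain j where j: "j < k" "count (A j) {u, x} < count (Bm j) {u, x}"
    proof -
      have "(\<Sum>i<k. count (A i) {u, x}) < (\<Sum>i<k. count (Bm i) {u, x})"
        using A ux cnt by (simp add: decomposition_def)
      then show thesis using that by (meson lessThan_iff not_less sum_mono)
    qed
    have one: "count (Bm i) {u, x} \<le> 1" if "i < k" for i
      using pe that linear_forest_count_le[of V "Bm i"] by (simp add: partial_enclosure_def)
    \<comment> \<open>A linear forest contains \<open>ux\<close> at most once, and
      \<open>mu \<ge> 2\<close> copies are placed; hence a second class contains it.\<close>
    obtain j' where j': "j' < k" "j' \<noteq> j" "{u, x} \<in># Bm j'"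
    proof -
      have "(\<Sum>i<k. count (Bm i) {u, x}) = count (Bm j) {u, x} + (\<Sum>i\<in>{..<k} - {j}. count (Bm i) {u, x})"
        using j(1) by (intro sum.remove) auto
      then have "(\<Sum>i\<in>{..<k} - {j}. count (Bm i) {u, x}) \<noteq> 0"
        using one[OF j(1)] cnt t(2) by linarith
      then obtain i where "i \<in> {..<k} - {j}" "count (Bm i) {u, x} \<noteq> 0"
        by (meson sum.neutral)
      then show thesis using that[of i] by (simp add: count_eq_zero_iff)
    qed
    define G where "G = Bm j - {#{u, x}#}"
    have "{u, x} \<in># Bm j" using j(2) by (metis count_greater_zero_iff gr_zeroI not_less_zero)
    then have G: "Bm j = add_mset {u, x} G" by (simp add: G_def)
    have lfG: "linear_forest V G"
      using pe j(1) G by (metis linear_forest_remove_edge partial_enclosure_def)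
    have "v \<notin> {u, x}" using uv x by auto
    then have "deg G u + deg G v \<le> 1" using t(3)[OF j(1)] by (simp add: G)
    then have lf: "linear_forest V (add_mset {u, v} G)"
      using linear_forest_add_edge[OF lfG V uvV uv(2)] by simp
    define B' where "B' = Bm(j := add_mset {u, v} G)"
    have upd: "(\<Sum>i<k. count (B' i) f) + of_bool (f = {u, x}) = (\<Sum>i<k. count (Bm i) f) + of_bool (f = {u, v})" for f
    proof -
      have "count (Bm j) f = of_bool (f = {u, x}) + count G f"
        unfolding G by (cases "f = {u, x}") simp_all
      moreover have "count (add_mset {u, v} G) f = of_bool (f = {u, v}) + count G f"
        by (cases "f = {u, v}") simp_all
      ultimately show ?thesis
        using sum_fun_upd[OF j(1), of "\<lambda>M. count M f" Bm "add_mset {u, v} G"] unfolding B'_def by linarith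
    qed
    have "A j \<subseteq># G"
    proof (rule mset_subset_eqI)
      fix f
      have "A j \<subseteq># Bm j" using pe j(1) by (simp add: partial_enclosure_def)
      then have "count (A j) f \<le> count (Bm j) f" by (simp add: mset_subset_eq_count)
      then show "count (A j) f \<le> count G f" using j(2) by (cases "f = {u, x}") (auto simp: G)
    qed
    then have Aj: "A j \<subseteq># add_mset {u, v} G"
      by (metis add_mset_add_single mset_subset_eq_add_left subset_mset.order_trans)
    have "(\<Sum>i<k. count (B' i) f) \<le> mu" if "is_edge V f" for f
    proof -
      have "(\<Sum>i<k. count (Bm i) f) \<le> mu" using pe that by (simp add: partial_enclosure_def)
      then show ?thesis using upd[of f] miss uv by (cases "f = {u, v}") auto
    qed
    then have "partial_enclosure mu V k A B'"
      using pe lf Aj by (auto simp: partial_enclosure_def B'_def)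
    moreover have "s \<le> size (B' i)" if "i < k" for i
      using Bm(1) that G by (cases "i = j") (auto simp: P_def B'_def)
    ultimately have "P B'" by (simp add: P_def)
    moreover have "tot B' = tot Bm"
      using sum_fun_upd[OF j(1), of size Bm "add_mset {u, v} G"] G by (simp add: B'_def[symmetric] tot_def)
    ultimately have "opt B'" by (simp add: opt_def)
    moreover have "{u, v} \<noteq> {u, x}" using \<open>v \<notin> {u, x}\<close> by auto
    then have "(\<Sum>i<k. count (B' i) {u, x}) < mu" using upd[of "{u, x}"] cnt t(2) by auto
    \<comment> \<open>In \<open>B'\<close> the edge \<open>ux\<close> is missing, so tightness
      applies to \<open>u\<close> and \<open>x\<close>. Class \<open>j'\<close> is unchanged, and
      its own copy of \<open>ux\<close> already accounts for the total degree 2.\<close>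
    ultimately have "deg (B' j') u + deg (B' j') x = 2" using tight[of B' u x] ux j' by blast
    then have d: "deg (Bm j') u + deg (Bm j') x = 2" using j' by (simp add: B'_def)
    obtain M where M: "Bm j' = add_mset {u, x} M" using j'(3) by (metis mset_add)
    have d': "deg (Bm j') u = 1" "deg (Bm j') x = 1" using d by (simp_all add: M)
    have "linear_forest V (add_mset {u, v} (Bm j'))"
      using pe j' d' t(3)[OF j'(1)] uvV uv(2) x V
      by (intro linear_forest_add_edge_isolated[where x = x]) (auto simp: partial_enclosure_def)
    then show False using not_addable[OF \<open>opt Bm\<close>, of "{u, v}" j'] e miss uv j'(1) by simp
  qed
  then have "decomposition mu V k Bm"
    using partial_enclosure_complete[OF _ V] Bm(1) by (auto simp: P_def)
  then show ?thesis using Bm(1) by (auto simp: P_def)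
qed

section \<open>Filling up classes with fewer than one or two edges\<close>

lemma linear_forest_single:
  assumes "finite V" "is_edge V e"
  shows "linear_forest V {#e#}"
proof -
  obtain u v where "e = {u, v}" "u \<noteq> v" using assms(2) by (auto simp: is_edge_def card_2_iff)
  then show ?thesis using linear_forest_add_edge[OF linear_forest_empty[OF assms(1)] assms(1), of u v] assms
    by (simp add: is_edge_def)
qed

text \<open>Distinct edges share at most one vertex, so beside \<open>e\<close> the ends of
  \<open>f\<close> have total degree at most 1.\<close>

lemma linear_forest_pair:
  assumes "finite V" "is_edge V e" "is_edge V f" "e \<noteq> f"
  shows "linear_forest V {#f, e#}"
proof -
  obtain u v where f: "f = {u, v}" "u \<noteq> v" using assms(3) by (auto simp: is_edge_def card_2_iff)
  have "\<not> (u \<in> e \<and> v \<in> e)"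
  proof
    assume "u \<in> e \<and> v \<in> e"
    moreover have "finite e" "card e = 2" using assms(2) by (auto simp: is_edge_def card_ge_0_finite)
    ultimately have "f = e" using f by (intro card_subset_eq) auto
    then show False using assms(4) by simp
  qed
  then have "deg {#e#} u + deg {#e#} v \<le> 1" by auto
  then show ?thesis
    using linear_forest_add_edge[OF linear_forest_single[OF assms(1,2)] assms(1), of u v] f assms(3)
    by (simp add: is_edge_def)
qed

text \<open>Each edge has \<open>mu - lam\<close> spare copies, which act as its capacity; every
  empty class requests one copy of any edge.\<close>

lemma fill_empty_classes:
  assumes V: "finite V" and A: "decomposition lam V k A" "lam < mu"
    and lf: "\<And>i. i < k \<Longrightarrow> linear_forest V (A i)"
    and card: "card {i. i < k \<and> A i = {#}} \<le> (mu - lam) * card (edges V)"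
  shows "\<exists>B. partial_enclosure mu V k A B \<and> (\<forall>i<k. 1 \<le> size (B i))"
proof -
  define J where "J = {i. i < k \<and> A i = {#}}"
  have finJ: "finite J" by (simp add: J_def)
  obtain h where h: "\<And>i. i \<in> J \<Longrightarrow> is_edge V (h i)" "\<And>e. is_edge V e \<Longrightarrow> card {i\<in>J. h i = e} \<le> mu - lam"
    using capacity_assignment[of "edges V" J "\<lambda>_. mu - lam"] V finJ card
    by (auto simp: J_def mult.commute)
  define B where "B i = A i + (if i \<in> J then {#h i#} else {#})" for i
  have cnt: "(\<Sum>i<k. count (B i) e) \<le> mu" if e: "is_edge V e" for e
  proof -
    have "(\<Sum>i<k. count (if i \<in> J then {#h i#} else {#}) e) = (\<Sum>i\<in>{i\<in>J. h i = e}. 1)"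
      by (intro sum.mono_neutral_cong_right) (auto simp: J_def)
    then have "(\<Sum>i<k. count (B i) e) = lam + card {i\<in>J. h i = e}"
      using A e by (simp add: B_def sum.distrib decomposition_def)
    then show ?thesis using h(2)[OF e] A(2) by linarith
  qed
  have "linear_forest V (B i)" if "i < k" for i
    using lf[OF that] h(1)[of i] linear_forest_single[OF V, of "h i"] by (auto simp: B_def J_def)
  then have "partial_enclosure mu V k A B"
    using cnt by (simp add: partial_enclosure_def B_def)
  moreover have "1 \<le> size (B i)" if "i < k" for i
  proof (cases "A i = {#}")
    case True
    then show ?thesis using that by (simp add: B_def J_def)
  next
    case False
    then show ?thesis by (simp add: B_def Suc_le_eq nonempty_has_size)
  qed
  ultimately show ?thesis by blast
qed

text \<open>The edges are handed out in two rounds. The first gives one edge to each empty class;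
  the second gives one more to every class that then has a single edge, which has to be avoided so
  as not to double it.\<close>

lemma fill_small_classes:
  assumes V: "finite V" and A: "decomposition lam V k A" "lam < mu"
    and lf: "\<And>i. i < k \<Longrightarrow> linear_forest V (A i)"
    and card: "2 * card {i. i < k \<and> A i = {#}} + card {i. i < k \<and> size (A i) = 1} \<le> (mu - lam) * card (edges V)"
    and card1: "\<And>e. is_edge V e \<Longrightarrow>
      card {i. i < k \<and> A i = {#e#}} + card {i. i < k \<and> A i = {#}} \<le> (mu - lam) * (card (edges V) - 1)"
  shows "\<exists>B. partial_enclosure mu V k A B \<and> (\<forall>i<k. 2 \<le> size (B i))"
proof -
  define J where "J = {i. i < k \<and> A i = {#}}"
  define S where "S = {i. i < k \<and> size (A i) = 1}"
  define d where "d = mu - lam"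
  have fin: "finite J" "finite S" "finite (edges V)" using V by (auto simp: J_def S_def)
  have disj: "J \<inter> S = {}" by (auto simp: J_def S_def)
  have "card J \<le> d * card (edges V)" using card by (simp add: J_def d_def)
  then obtain h1 where h1: "\<And>i. i \<in> J \<Longrightarrow> is_edge V (h1 i)" "\<And>e. is_edge V e \<Longrightarrow> card {i\<in>J. h1 i = e} \<le> d"
    using capacity_assignment[of "edges V" J "\<lambda>_. d"] V fin by (auto simp: mult.commute)
  define c where "c e = card {i\<in>J. h1 i = e}" for e
  define a where "a e = d - c e" for e
  \<comment> \<open>The edge a class holds after the first round, forbidden in the second. The
    choice is meant for the classes in \<open>S\<close>, where the edge is unique.\<close>
  define g where "g i = (if i \<in> J then h1 i else SOME e. e \<in># A i)" for i
  have gS: "A i = {#g i#}" if "i \<in> S" for i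
  proof -
    have "size (A i) = 1" using that by (simp add: S_def)
    then obtain e where "A i = {#e#}" by (metis size_1_singleton_mset)
    then show ?thesis using that disj by (auto simp: g_def)
  qed
  have sum_c: "sum c (edges V) = card J"
    unfolding c_def by (rule sum_card_fibres) (use fin h1 in auto)
  have sum_a: "sum a F + sum c F = d * card F" if "F \<subseteq> edges V" for F
  proof -
    have "sum a F + sum c F = (\<Sum>e\<in>F. d)"
      unfolding sum.distrib[symmetric] using that h1(2) by (intro sum.cong) (auto simp: a_def c_def)
    then show ?thesis by simp
  qed
  have cardI: "card (J \<union> S) = card J + card S" using fin disj by (simp add: card_Un_disjoint)
  have "card (J \<union> S) \<le> sum a (edges V)"
    using sum_a[of "edges V"] sum_c card cardI by (simp add: J_def S_def d_def)
  \<comment> \<open>The number \<open>c e\<close> of copies of \<open>e\<close> used in the first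
    round adds to the requests forbidding \<open>e\<close> exactly as much as it spares the capacity
    outside \<open>e\<close>. It cancels, which is why the first round could be arbitrary and why
    (M3) involves only \<open>A\<close>.\<close>
  moreover have "card {i\<in>J \<union> S. g i = e} \<le> sum a (edges V - {e})" if e: "e \<in> edges V" for e
  proof -
    have "i \<in> S \<and> g i = e \<longleftrightarrow> i < k \<and> A i = {#e#}" for i
    proof
      assume "i < k \<and> A i = {#e#}"
      then have "i \<in> S" by (simp add: S_def)
      then show "i \<in> S \<and> g i = e" using gS[of i] \<open>i < k \<and> A i = {#e#}\<close> by simp
    next
      assume "i \<in> S \<and> g i = e"
      then show "i < k \<and> A i = {#e#}" using gS[of i] by (simp add: S_def)
    qed
    then have "{i\<in>S. g i = e} = {i. i < k \<and> A i = {#e#}}" by blast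
    moreover have "{i\<in>J. g i = e} = {i\<in>J. h1 i = e}" by (auto simp: g_def)
    moreover have "{i\<in>J \<union> S. g i = e} = {i\<in>J. g i = e} \<union> {i\<in>S. g i = e}" by blast
    ultimately have "{i\<in>J \<union> S. g i = e} = {i\<in>J. h1 i = e} \<union> {i. i < k \<and> A i = {#e#}}" by simp
    moreover have "{i\<in>J. h1 i = e} \<inter> {i. i < k \<and> A i = {#e#}} = {}" by (auto simp: J_def)
    ultimately have "card {i\<in>J \<union> S. g i = e} = c e + card {i. i < k \<and> A i = {#e#}}"
      using fin by (simp add: c_def card_Un_disjoint)
    moreover have "sum c (edges V - {e}) + c e = card J"
      using e fin sum_c by (simp add: sum.remove[of "edges V" e c])
    moreover have "sum a (edges V - {e}) + sum c (edges V - {e}) = d * (card (edges V) - 1)"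
      using sum_a[of "edges V - {e}"] e fin by (simp add: card_Diff_singleton)
    ultimately show ?thesis using card1[of e] e by (simp add: J_def d_def)
  qed
  ultimately obtain h2 where h2: "\<And>i. i \<in> J \<union> S \<Longrightarrow> is_edge V (h2 i) \<and> h2 i \<noteq> g i"
      "\<And>e. is_edge V e \<Longrightarrow> card {i\<in>J \<union> S. h2 i = e} \<le> a e"
    using avoiding_assignment[of "edges V" "J \<union> S" a g] fin by auto
  define X where "X i = (if i \<in> J then {#h1 i#} else {#}) + (if i \<in> J \<union> S then {#h2 i#} else {#})" for i
  define B where "B i = A i + X i" for i
  have cnt: "(\<Sum>i<k. count (B i) e) \<le> mu" if e: "is_edge V e" for e
  proof -
    have "(\<Sum>i<k. count (if i \<in> J then {#h1 i#} else {#}) e) = (\<Sum>i\<in>{i\<in>J. h1 i = e}. 1)"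
      by (intro sum.mono_neutral_cong_right) (auto simp: J_def)
    moreover have "(\<Sum>i<k. count (if i \<in> J \<union> S then {#h2 i#} else {#}) e) = (\<Sum>i\<in>{i\<in>J \<union> S. h2 i = e}. 1)"
      by (intro sum.mono_neutral_cong_right) (auto simp: J_def S_def)
    ultimately have "(\<Sum>i<k. count (B i) e) = lam + c e + card {i\<in>J \<union> S. h2 i = e}"
      using A e by (simp add: B_def X_def c_def sum.distrib decomposition_def)
    then show ?thesis using h1(2)[OF e] h2(2)[OF e] A(2) by (simp add: a_def d_def c_def)
  qed
  have B: "linear_forest V (B i) \<and> 2 \<le> size (B i)" if "i < k" for i
  proof -
    consider (J) "i \<in> J" | (S) "i \<in> S" "i \<notin> J" | (big) "i \<notin> J \<union> S" by auto
    then show ?thesis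
    proof cases
      case J
      then have "A i = {#}" by (simp add: J_def)
      then show ?thesis
        using J h1(1)[OF J] h2(1)[of i] linear_forest_pair[OF V, of "h1 i" "h2 i"] by (auto simp: B_def X_def g_def)
    next
      case S
      have "is_edge V (g i)" using gS[OF S(1)] A(1) that by (auto simp: decomposition_def)
      then show ?thesis
        using S gS[OF S(1)] h2(1)[of i] linear_forest_pair[OF V, of "g i" "h2 i"] by (auto simp: B_def X_def add_mset_commute)
    next
      case big
      then have "size (A i) \<noteq> 0" "size (A i) \<noteq> 1" using that by (auto simp: J_def S_def)
      then have "2 \<le> size (A i)" by linarith
      then show ?thesis using big lf[OF that] by (simp add: B_def X_def)
    qed
  qed
  then have "partial_enclosure mu V k A B"
    using cnt by (simp add: partial_enclosure_def B_def)
  then show ?thesis using B by blast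
qed

section \<open>Enclosings in Hamiltonian decompositions\<close>

text \<open>The sum in (M2) is the number of edges that the classes lack to reach
  \<open>n - m\<close> each, grouped by class size. Truncated subtraction gives 0 for the classes
  that are large enough.\<close>

lemma weighted_sum_S_card:
  "(\<Sum>i\<in>{i. i + m \<le> n}. (real n - real m - real i) * real (S_card k A i)) =
    real (\<Sum>j<k. n - (m + size (A j)))"
proof -
  define J where "J = {j. j < k \<and> size (A j) + m \<le> n}"
  have fin: "finite {i. i + m \<le> n}" by (rule finite_subset[of _ "{..n}"]) auto
  have "(\<Sum>j<k. real (n - (m + size (A j)))) = (\<Sum>j\<in>J. real n - real m - real (size (A j)))"
    by (rule sum.mono_neutral_cong_right) (auto simp: J_def of_nat_diff)
  also have "\<dots> = (\<Sum>i\<in>{i. i + m \<le> n}. \<Sum>j\<in>{j\<in>J. size (A j) = i}. real n - real m - real (size (A j)))"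
    by (rule sum.group[symmetric]) (use fin in \<open>auto simp: J_def\<close>)
  also have "\<dots> = (\<Sum>i\<in>{i. i + m \<le> n}. (real n - real m - real i) * real (S_card k A i))"
  proof (rule sum.cong)
    fix i assume "i \<in> {i. i + m \<le> n}"
    then have "{j\<in>J. size (A j) = i} = {j. j < k \<and> size (A j) = i}" by (auto simp: J_def)
    moreover have "(\<Sum>j\<in>{j\<in>J. size (A j) = i}. real n - real m - real (size (A j))) =
        (\<Sum>j\<in>{j\<in>J. size (A j) = i}. real n - real m - real i)" by (intro sum.cong) auto
    ultimately show "(\<Sum>j\<in>{j\<in>J. size (A j) = i}. real n - real m - real (size (A j))) =
        (real n - real m - real i) * real (S_card k A i)" by (simp add: S_card_def)
  qed simp
  finally show ?thesis by simp
qed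

lemma sum_of_bool_lessThan: "(\<Sum>i<k. of_bool (P i)) = card {i. i < k \<and> P i}" for k :: nat
proof -
  have "(\<Sum>i<k. of_bool (P i)) = (\<Sum>i\<in>{i. i < k \<and> P i}. 1::nat)"
    by (intro sum.mono_neutral_cong_right) auto
  then show ?thesis by simp
qed

section \<open>Necessity of the conditions\<close>

lemma size_filter_UN_le:
  fixes W :: "nat set"
  assumes "finite W"
  shows "size (filter_mset (\<lambda>e. e \<inter> W \<noteq> {}) M) \<le> (\<Sum>w\<in>W. deg M w)"
proof (induction M)
  case (add e M)
  have "of_bool (e \<inter> W \<noteq> {}) \<le> (\<Sum>w\<in>W. of_bool (w \<in> e) :: nat)"
  proof (cases "e \<inter> W = {}")
    case False
    then obtain w where w: "w \<in> e" "w \<in> W" by auto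
    then have "of_bool (w \<in> e) \<le> (\<Sum>w\<in>W. of_bool (w \<in> e) :: nat)"
      using assms by (intro member_le_sum) auto
    then show ?thesis using w False by simp
  qed simp
  moreover have "size (filter_mset (\<lambda>e. e \<inter> W \<noteq> {}) (add_mset e M)) =
      of_bool (e \<inter> W \<noteq> {}) + size (filter_mset (\<lambda>e. e \<inter> W \<noteq> {}) M)" by simp
  moreover have "(\<Sum>w\<in>W. deg (add_mset e M) w) = (\<Sum>w\<in>W. of_bool (w \<in> e)) + (\<Sum>w\<in>W. deg M w)"
    by (simp only: deg_simps sum.distrib)
  ultimately show ?case using add by linarith
qed simp

text \<open>Of the \<open>n + m\<close> edges of the cycle at most \<open>2 * m\<close> meet the
  \<open>m\<close> vertices outside \<open>{0..<n}\<close>, as each of these has degree 2.\<close>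

lemma hamiltonian_cycle_restrict:
  assumes "hamiltonian_cycle {0..<n+m} H"
  shows "n \<le> size (filter_mset (\<lambda>e. e \<subseteq> {0..<n}) H) + m"
proof -
  obtain vs where vs: "is_cycle vs" "set vs = {0..<n+m}" "H = cycle_edges vs"
    using assms by (auto simp: hamiltonian_cycle_def)
  have "length vs = n + m" using vs by (metis card_atLeastLessThan diff_zero distinct_card is_cycle_def)
  then have "n + m = size (filter_mset (\<lambda>e. e \<subseteq> {0..<n}) H) + size (filter_mset (\<lambda>e. \<not> e \<subseteq> {0..<n}) H)"
    by (metis multiset_partition size_cycle_edges size_union vs(3))
  also have "filter_mset (\<lambda>e. \<not> e \<subseteq> {0..<n}) H = filter_mset (\<lambda>e. e \<inter> {n..<n+m} \<noteq> {}) H"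
  proof (rule filter_mset_cong)
    fix e assume "e \<in># H"
    then have "e \<subseteq> {0..<n+m}" using cycle_edges_is_edge[OF vs(1)] vs by (auto simp: is_edge_def)
    then show "(\<not> e \<subseteq> {0..<n}) = (e \<inter> {n..<n+m} \<noteq> {})" by fastforce
  qed simp
  also have "size \<dots> \<le> (\<Sum>w\<in>{n..<n+m}. deg H w)" by (rule size_filter_UN_le) simp
  also have "\<dots> = (\<Sum>w\<in>{n..<n+m}. 2)"
    using deg_cycle_edges[OF vs(1)] vs by (intro sum.cong) auto
  finally show ?thesis by simp
qed

lemma size_filter_le_remove:
  "size (filter_mset P M) \<le> size (filter_mset (\<lambda>e. P e \<and> e \<noteq> f) M) + count M f"
  by (induction M) auto

lemma edges_restrict: "{e \<in> edges {0..<n+m}. e \<subseteq> {0..<n}} = edges {0..<n}"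
  by (auto simp: is_edge_def)

context
  fixes n m mu lam k :: nat and A H :: "nat \<Rightarrow> nat set multiset"
  assumes A: "decomposition lam {0..<n} k A"
    and H: "hamiltonian_decomposition mu {0..<n+m} k H"
    and sub: "\<And>i. i < k \<Longrightarrow> A i \<subseteq># H i"
begin

lemma enclosed_decomposition: "decomposition mu {0..<n+m} k H"
  using H by (simp add: hamiltonian_decomposition_def)

lemma enclosed_cycle: "i < k \<Longrightarrow> hamiltonian_cycle {0..<n+m} (H i)"
  using H by (simp add: hamiltonian_decomposition_def)

text \<open>The \<open>k\<close> cycles with \<open>n + m\<close> edges each use up all
  \<open>mu * ((n + m) choose 2)\<close> edges.\<close>

lemma enclosed_number_of_classes:
  assumes "n + m > 0"
  shows "2 * k = mu * (n + m - 1)"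
proof -
  have "size (H i) = n + m" if "i < k" for i
    using enclosed_cycle[OF that] unfolding hamiltonian_cycle_def
    by (metis card_atLeastLessThan diff_zero distinct_card is_cycle_def size_cycle_edges)
  then have "k * (n + m) = mu * ((n + m) choose 2)"
    using decomposition_sum_size[OF enclosed_decomposition] by simp
  then have "2 * (k * (n + m)) = mu * (2 * ((n + m) choose 2))" by simp
  also have "2 * ((n + m) choose 2) = (n + m) * (n + m - 1)"
    by (cases "n + m") (simp_all add: choose_two)
  finally have "(n + m) * (2 * k) = (n + m) * (mu * (n + m - 1))" by (simp only: mult_ac)
  then show ?thesis using assms by (metis mult_left_cancel neq0_conv)
qed

text \<open>A class of \<open>H\<close> has at least \<open>n - m\<close> edges inside
  \<open>{0..<n}\<close>, so what a class of \<open>A\<close> lacks must come from the copies that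
  \<open>A\<close> does not use. The added term on the left avoids a subtraction.\<close>

lemma enclosed_deficiency:
  "(\<Sum>i<k. n - (m + size (A i))) + lam * (n choose 2) \<le> mu * (n choose 2)"
proof -
  define r where "r i = size (filter_mset (\<lambda>e. e \<subseteq> {0..<n}) (H i))" for i
  have "n - (m + size (A i)) + size (A i) \<le> r i" if i: "i < k" for i
  proof -
    have "filter_mset (\<lambda>e. e \<subseteq> {0..<n}) (A i) = A i"
      using A i by (auto simp: decomposition_def is_edge_def filter_mset_eq_conv)
    then have "size (A i) \<le> r i"
      using multiset_filter_mono[OF sub[OF i]] size_mset_mono unfolding r_def by metis
    then show ?thesis using hamiltonian_cycle_restrict[OF enclosed_cycle[OF i]] by (simp add: r_def)
  qed
  then have "(\<Sum>i<k. n - (m + size (A i)) + size (A i)) \<le> (\<Sum>i<k. r i)"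
    by (intro sum_mono) auto
  also have "\<dots> = mu * (n choose 2)"
    using decomposition_sum_filter[OF enclosed_decomposition, of "\<lambda>e. e \<subseteq> {0..<n}"]
    unfolding edges_restrict by (simp add: r_def card_edges)
  finally show ?thesis
    using decomposition_sum_size[OF A] by (simp add: sum.distrib)
qed

text \<open>A class of \<open>H\<close> has at least two edges inside \<open>{0..<n}\<close> and,
  being a cycle of length at least 4, contains \<open>f\<close> at most once. So it has an edge
  there other than \<open>f\<close>; where the class of \<open>A\<close> is empty or just
  \<open>f\<close>, that edge is an added one.\<close>

lemma enclosed_singletons:
  assumes nm: "n = m + 2" "m > 0" and f: "is_edge {0..<n} f"
  shows "card {i. i < k \<and> A i = {#}} + card {i. i < k \<and> A i = {#f#}} + lam * ((n choose 2) - 1)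
    \<le> mu * ((n choose 2) - 1)"
proof -
  define t where "t i = size (filter_mset (\<lambda>e. e \<subseteq> {0..<n} \<and> e \<noteq> f) (H i))" for i
  define a where "a i = size (filter_mset (\<lambda>e. e \<noteq> f) (A i))" for i
  have le: "of_bool (A i = {#}) + of_bool (A i = {#f#}) + a i \<le> t i" if i: "i < k" for i
  proof -
    have "filter_mset (\<lambda>e. e \<subseteq> {0..<n} \<and> e \<noteq> f) (A i) = filter_mset (\<lambda>e. e \<noteq> f) (A i)"
      using A i by (intro filter_mset_cong) (auto simp: decomposition_def is_edge_def)
    then have "a i \<le> t i"
      using multiset_filter_mono[OF sub[OF i]] size_mset_mono unfolding a_def t_def by metis
    moreover have "1 \<le> t i"
    proof -
      obtain vs where vs: "is_cycle vs" "set vs = {0..<n+m}" "H i = cycle_edges vs"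
        using enclosed_cycle[OF i] by (auto simp: hamiltonian_cycle_def)
      have "length vs = n + m" using vs by (metis card_atLeastLessThan diff_zero distinct_card is_cycle_def)
      then have "count (H i) f \<le> 1"
        using count_cycle_edges_le[of vs f] vs nm by (simp add: is_cycle_def)
      then show ?thesis
        using hamiltonian_cycle_restrict[OF enclosed_cycle[OF i]] nm
          size_filter_le_remove[of "\<lambda>e. e \<subseteq> {0..<n}" "H i" f] by (simp add: t_def)
    qed
    moreover have "a i = 0" if "A i = {#} \<or> A i = {#f#}" using that by (auto simp: a_def)
    ultimately show ?thesis by (cases "A i = {#}") auto
  qed
  have rm: "card {e \<in> edges {0..<n}. e \<noteq> f} = (n choose 2) - 1"
  proof -
    have "{e \<in> edges {0..<n}. e \<noteq> f} = edges {0..<n} - {f}" by auto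
    then show ?thesis using f by (simp add: card_edges)
  qed
  have "{e \<in> edges {0..<n+m}. e \<subseteq> {0..<n} \<and> e \<noteq> f} = {e \<in> edges {0..<n}. e \<noteq> f}"
    using edges_restrict[of n m] by blast
  then have sum_t: "(\<Sum>i<k. t i) = mu * ((n choose 2) - 1)"
    using decomposition_sum_filter[OF enclosed_decomposition, of "\<lambda>e. e \<subseteq> {0..<n} \<and> e \<noteq> f"] rm
    by (simp add: t_def)
  have sum_a: "(\<Sum>i<k. a i) = lam * ((n choose 2) - 1)"
    using decomposition_sum_filter[OF A, of "\<lambda>e. e \<noteq> f"] rm by (simp add: a_def)
  have "(\<Sum>i<k. of_bool (A i = {#}) + of_bool (A i = {#f#}) + a i) \<le> (\<Sum>i<k. t i)"
    using le by (intro sum_mono) auto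
  then show ?thesis unfolding sum.distrib sum_of_bool_lessThan sum_t sum_a .
qed

end

section \<open>Sufficiency of the conditions\<close>

lemma enclosing_exists:
  fixes n m mu lam k :: nat
  assumes pos: "n > 0" "m > 0"
    and cases: "mu > lam \<and> m \<ge> n - 1 \<or> lam = 1 \<and> mu = 2 \<and> m = n - 2 \<or> mu > lam \<and> n = 3 \<and> m = 1"
    and A: "decomposition lam {0..<n} k A" "\<And>i. i < k \<Longrightarrow> linear_forest {0..<n} (A i)"
    and M1: "2 * k = mu * (n + m - 1)"
    and M2: "(\<Sum>i<k. n - (m + size (A i))) \<le> (mu - lam) * (n choose 2)"
    and M3: "\<And>e. n = m + 2 \<Longrightarrow> is_edge {0..<n} e \<Longrightarrow>
      card {i. i < k \<and> A i = {#e#}} + card {i. i < k \<and> A i = {#}} \<le> (mu - lam) * ((n choose 2) - 1)"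
  shows "enclosed_in_hamiltonian mu n m k A"
proof -
  have lt: "lam < mu" using cases by auto
  have card: "card (edges {0..<n}) = n choose 2" by (simp add: card_edges)
  have fill2: "\<exists>B. partial_enclosure mu {0..<n} k A B \<and> (\<forall>i<k. 2 \<le> size (B i))" if nm: "n = m + 2"
  proof (rule fill_small_classes[OF _ A(1) lt A(2)])
    have "(\<Sum>i<k. n - (m + size (A i))) = (\<Sum>i<k. 2 * of_bool (A i = {#}) + of_bool (size (A i) = 1))"
    proof (rule sum.cong)
      fix i
      show "n - (m + size (A i)) = 2 * of_bool (A i = {#}) + of_bool (size (A i) = 1)"
        using nm by (cases "size (A i)") auto
    qed simp
    also have "\<dots> = 2 * card {i. i < k \<and> A i = {#}} + card {i. i < k \<and> size (A i) = 1}"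
      by (simp add: sum.distrib sum_of_bool_lessThan flip: sum_distrib_left)
    finally show "2 * card {i. i < k \<and> A i = {#}} + card {i. i < k \<and> size (A i) = 1}
        \<le> (mu - lam) * card (edges {0..<n})" using M2 card by simp
    show "card {i. i < k \<and> A i = {#e#}} + card {i. i < k \<and> A i = {#}} \<le> (mu - lam) * (card (edges {0..<n}) - 1)"
      if "is_edge {0..<n} e" for e using M3[OF nm that] card by simp
  qed simp
  have "\<exists>B. partial_enclosure mu {0..<n} k A B \<and> decomposition mu {0..<n} k B \<and> (\<forall>i<k. n - m \<le> size (B i))"
  proof -
    \<comment> \<open>The cases are a required class size of 0, 1 and 2; the last is split by the
      way in which the remaining edges are placed.\<close>
    consider (i) "m \<ge> n" | (i') "n = m + 1" | (ii) "n = m + 2" "lam = 1" "mu = 2" | (iii) "n = 3" "m = 1"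
      using cases pos by linarith
    then show ?thesis
    proof cases
      case i
      have "partial_enclosure mu {0..<n} k A A"
        using A lt by (auto simp: partial_enclosure_def decomposition_def)
      moreover have "2 * (mu * (n - 1)) \<le> 2 * k"
      proof -
        have "2 * (n - 1) \<le> n + m - 1" using i by arith
        then show ?thesis unfolding M1 using mult_le_mono2[of "2 * (n - 1)" "n + m - 1" mu] by (simp add: mult_ac)
      qed
      then have "mu * (n - 1) \<le> k" by simp
      ultimately show ?thesis
        using complete_enclosure[OF _ A(1) lt, of A "n - m"] i by simp
    next
      case i'
      have "(\<Sum>i<k. n - (m + size (A i))) = (\<Sum>i\<in>{i. i < k \<and> A i = {#}}. 1)"
        using i' by (intro sum.mono_neutral_cong_right) (auto simp: Suc_le_eq nonempty_has_size)
      then have "card {i. i < k \<and> A i = {#}} \<le> (mu - lam) * card (edges {0..<n})" using M2 card by simp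
      from fill_empty_classes[OF _ A(1) lt A(2) this]
      obtain B where B: "partial_enclosure mu {0..<n} k A B" "\<forall>i<k. 1 \<le> size (B i)" by auto
      have "2 * (mu * (n - 1)) = 2 * k" unfolding M1 i' by simp
      then have "mu * (n - 1) \<le> k" by simp
      then show ?thesis
        using complete_enclosure[OF _ A(1) lt B(1), of 1] B(2) i' by simp
    next
      case ii
      then have nm: "n = m + 2" by simp
      obtain B where B: "partial_enclosure mu {0..<n} k A B" "\<forall>i<k. 2 \<le> size (B i)"
        using fill2[OF nm] by blast
      have "mu * (n - 1) \<le> k + 1" using M1 ii by simp
      then show ?thesis
        using complete_enclosure[OF _ A(1) lt B(1), of 2] B(2) ii pos by simp
    next
      \<comment> \<open>Here \<open>2 * k = 3 * mu\<close>, too small in general for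
        \<open>complete_enclosure\<close>. Two edges in each class already amount to all
        \<open>3 * mu\<close> edges on three vertices, so none can be missing.\<close>
      case iii
      obtain B where B: "partial_enclosure mu {0..<n} k A B" "\<forall>i<k. 2 \<le> size (B i)"
        using fill2 iii by auto
      have "\<not> (\<Sum>i<k. count (B i) e) < mu" if e: "is_edge {0..<n} e" for e
      proof
        assume "(\<Sum>i<k. count (B i) e) < mu"
        then have "(\<Sum>i<k. size (B i)) + 1 \<le> mu * 3"
          using partial_enclosure_sum_filter[OF B(1), of "{e}" "\<lambda>_. True"] e card iii
          by (simp add: choose_two)
        moreover have "(\<Sum>i<k. 2) \<le> (\<Sum>i<k. size (B i))" using B(2) by (intro sum_mono) auto
        ultimately show False using M1 iii by simp
      qed
      then show ?thesis
        using partial_enclosure_complete[OF B(1)] B iii by auto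
    qed
  qed
  then obtain B where B: "partial_enclosure mu {0..<n} k A B" "decomposition mu {0..<n} k B"
      "\<And>i. i < k \<Longrightarrow> n - m \<le> size (B i)" by blast
  have "\<exists>H. hamiltonian_decomposition mu {0..<n+m} k H \<and> (\<forall>i<k. B i \<subseteq># H i)"
    using pos M1 B by (intro hamiltonian_embedding) (force simp: partial_enclosure_def)+
  then show ?thesis
    using B(1) unfolding enclosed_in_hamiltonian_def partial_enclosure_def
    by (meson subset_mset.order_trans)
qed

theorem theorem1:
  fixes n m mu lam k :: nat and A :: "nat \<Rightarrow> nat set multiset"
  assumes pos: "n > 0" "m > 0" "mu > 0" "lam > 0" "k > 0"
    and cases: "(mu > lam \<and> m \<ge> n - 1) \<or> (lam = 1 \<and> mu = 2 \<and> m = n - 2)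
                \<or> (mu > lam \<and> n = 3 \<and> m = 1)"
    and A: "strong_path_decomposition lam {0..<n} k A"
  shows "enclosed_in_hamiltonian mu n m k A \<longleftrightarrow>
    (real k = real mu * (real m + real n - 1) / 2) \<and>
    (\<Sum>i\<in>{i. i + m \<le> n}. (real n - real m - real i) * real (S_card k A i))
        \<le> (real mu - real lam) * (real n * (real n - 1) / 2) \<and>
    (((lam = 1 \<and> mu = 2 \<and> m = n - 2) \<or> (mu > lam \<and> n = 3 \<and> m = 1)) \<longrightarrow>
       (\<forall>u v. u < n \<and> v < n \<and> u \<noteq> v \<longrightarrow>
          real (S1_card k A u v)
            \<le> (real mu - real lam) * (real n * (real n - 1) / 2 - 1) - real (S_card k A 0)))"
  (is "?E \<longleftrightarrow> ?M1 \<and> ?M2 \<and> (?C \<longrightarrow> ?M3)")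
proof -
  have dec: "decomposition lam {0..<n} k A"
    using A by (simp add: strong_path_decomposition_def path_decomposition_def)
  have lf: "linear_forest {0..<n} (A i)" if "i < k" for i
    using A that by (intro strong_imp_linear_forest)
      (auto simp: strong_path_decomposition_def path_decomposition_def decomposition_def)
  have lt: "lam < mu" using cases by auto
  \<comment> \<open>Since \<open>m\<close> is positive, \<open>m = n - 2\<close> is a genuine and
    not a truncated difference.\<close>
  have C: "n = m + 2" if ?C using that pos by auto
  have M1: "?M1 \<longleftrightarrow> 2 * k = mu * (n + m - 1)"
  proof -
    have "real (2 * k) = real (mu * (n + m - 1)) \<longleftrightarrow> ?M1"
      using pos by (auto simp: of_nat_diff field_simps)
    then show ?thesis by (simp only: of_nat_eq_iff)
  qed
  have M2: "?M2 \<longleftrightarrow> (\<Sum>i<k. n - (m + size (A i))) \<le> (mu - lam) * (n choose 2)"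
  proof -
    have "?M2 \<longleftrightarrow> real (\<Sum>i<k. n - (m + size (A i))) \<le> real ((mu - lam) * (n choose 2))"
      using lt by (simp only: weighted_sum_S_card real_choose_2[symmetric] of_nat_mult of_nat_diff less_imp_le)
    then show ?thesis by (simp only: of_nat_le_iff)
  qed
  have M3: "?M3 \<longleftrightarrow> (\<forall>e. is_edge {0..<n} e \<longrightarrow>
      card {i. i < k \<and> A i = {#e#}} + card {i. i < k \<and> A i = {#}} \<le> (mu - lam) * ((n choose 2) - 1))"
    if ?C
  proof -
    \<comment> \<open>This makes the subtraction of 1 over the natural numbers agree with the one
      over the reals.\<close>
    have "(n choose 2) \<ge> 1" using C[OF that] by (simp add: Suc_le_eq)
    then have "real ((mu - lam) * ((n choose 2) - 1)) = (real mu - real lam) * (real n * (real n - 1) / 2 - 1)"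
      using lt by (simp add: of_nat_diff flip: real_choose_2)
    then have "real (S1_card k A u v) \<le> (real mu - real lam) * (real n * (real n - 1) / 2 - 1) - real (S_card k A 0)
      \<longleftrightarrow> real (S1_card k A u v + S_card k A 0) \<le> real ((mu - lam) * ((n choose 2) - 1))" for u v
      by auto
    then have "?M3 \<longleftrightarrow> (\<forall>u v. u < n \<and> v < n \<and> u \<noteq> v \<longrightarrow>
        S1_card k A u v + S_card k A 0 \<le> (mu - lam) * ((n choose 2) - 1))"
      by (simp only: of_nat_le_iff)
    also have "\<dots> \<longleftrightarrow> (\<forall>e. is_edge {0..<n} e \<longrightarrow>
      card {i. i < k \<and> A i = {#e#}} + card {i. i < k \<and> A i = {#}} \<le> (mu - lam) * ((n choose 2) - 1))"
      unfolding S1_card_def S_card_def size_eq_0_iff_empty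
    proof (intro iffI allI impI)
      fix e assume *: "\<forall>u v. u < n \<and> v < n \<and> u \<noteq> v \<longrightarrow>
        card {j. j < k \<and> A j = {#{u, v}#}} + card {j. j < k \<and> A j = {#}} \<le> (mu - lam) * ((n choose 2) - 1)"
        "is_edge {0..<n} e"
      then obtain u v where "e = {u, v}" "u \<noteq> v" "u < n" "v < n" by (auto simp: is_edge_def card_2_iff)
      then show "card {i. i < k \<and> A i = {#e#}} + card {i. i < k \<and> A i = {#}} \<le> (mu - lam) * ((n choose 2) - 1)"
        using *(1) by blast
    qed (simp add: is_edge_def)
    finally show ?thesis .
  qed
  show ?thesis
  proof (intro iffI conjI impI)
    assume ?E
    then obtain H where H: "hamiltonian_decomposition mu {0..<n+m} k H" "\<And>i. i < k \<Longrightarrow> A i \<subseteq># H i"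
      by (auto simp: enclosed_in_hamiltonian_def)
    show ?M1 unfolding M1 using enclosed_number_of_classes[OF dec H] pos by simp
    show ?M2 unfolding M2
      using enclosed_deficiency[OF dec H] pos by (simp add: diff_mult_distrib)
    show ?M3 if ?C unfolding M3[OF that] diff_mult_distrib
    proof (intro allI impI)
      fix e assume "is_edge {0..<n} e"
      from enclosed_singletons[OF dec H C[OF that] pos(2) this]
      show "card {i. i < k \<and> A i = {#e#}} + card {i. i < k \<and> A i = {#}}
          \<le> mu * ((n choose 2) - 1) - lam * ((n choose 2) - 1)" by linarith
    qed
  next
    assume M: "?M1 \<and> ?M2 \<and> (?C \<longrightarrow> ?M3)"
    then have M3': "card {i. i < k \<and> A i = {#e#}} + card {i. i < k \<and> A i = {#}} \<le> (mu - lam) * ((n choose 2) - 1)"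
      if "n = m + 2" "is_edge {0..<n} e" for e
    proof -
      \<comment> \<open>Case (i) would give \<open>m \<ge> m + 1\<close>, so only (ii) and (iii),
        for which (M3) is available, remain.\<close>
      have ?C using cases that(1) by linarith
      then show ?thesis using M M3 that(2) by blast
    qed
    show ?E
    proof (rule enclosing_exists[OF pos(1,2) cases dec lf])
      show "2 * k = mu * (n + m - 1)" using M M1 by blast
      show "(\<Sum>i<k. n - (m + size (A i))) \<le> (mu - lam) * (n choose 2)" using M M2 by blast
    qed (use M3' in auto)
  qed
qed

end
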